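(* Let $G \subset \mathbb{R}^n$ be an open set, and let $\mu$ be a probability measure on $(G, \mathcal{B}(G))$ which satisfies a logarithmic Sobolev inequality with constant $\sigma^2 > 0$. Let $f \colon G \to \mathbb{R}$ be a $\mathcal{C}^2$-smooth function such that $f \in L^1(\mu)$ and $\partial_i f \in L^1(\mu)$ for all $i=1,\ldots,n$. Assume that $\int_G f\, d\mu = 0$ and $\int_G \partial_i f\, d\mu = 0$ for all $i = 1,\ldots,n$. Moreover, assume that $$\lVert f''(x) \rVert_{\mathrm{Op}} \le 1 \ \text{ for all } x \in G \qquad\text{and}\qquad \int_G \lVert f'' \rVert_{\mathrm{HS}}^2\, d\mu \le b^2$$ for some $b \ge 0$. Then $$\int_G \exp\left(\frac{1}{2\sigma^2(1+b^2)}|f|\right) d\mu \le 2.$$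
   Context: $\mathcal B(G)$ is the Borel $\sigma$-algebra. $\mu$ satisfies a logarithmic Sobolev inequality with constant $\sigma^2>0$ if for all locally Lipschitz functions $u\colon G\to\mathbb{R}$, $$\mathrm{Ent}_\mu(u^2)\le 2\sigma^2\int_G|\nabla u|^2d\mu,$$ where $\mathrm{Ent}_\mu(u^2)=\int u^2\log u^2\,d\mu-\int u^2d\mu\,\log\int u^2d\mu$ and $|\nabla u|$ is the Euclidean norm of the gradient. $\partial_if$ is the $i$-th partial derivative, $f''$ the Hessian of $f$, and $\lVert\cdot\rVert_{\mathrm{Op}}$, $\lVert\cdot\rVert_{\mathrm{HS}}$ denote the operator norm and the Hilbert–Schmidt norm. *)

theory Defs
  imports "HOL-Probability.Probability"
begin

text \<open>
  Functions on an open set \<open>G\<close> are total functions on \<open>real ^ 'n\<close>; everything below depends only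
  on their values on \<open>G\<close>, since \<open>G\<close> is open and all derivatives are taken at points of \<open>G\<close>.
\<close>

definition partial_deriv :: "'n \<Rightarrow> (real ^ 'n \<Rightarrow> real) \<Rightarrow> real ^ 'n \<Rightarrow> real" where
  "partial_deriv i f x = deriv (\<lambda>t. f (x + t *\<^sub>R axis i 1)) 0"

definition gradient :: "(real ^ 'n \<Rightarrow> real) \<Rightarrow> real ^ 'n \<Rightarrow> real ^ 'n" where
  "gradient f x = (\<chi> i. partial_deriv i f x)"

definition hessian :: "(real ^ 'n \<Rightarrow> real) \<Rightarrow> real ^ 'n \<Rightarrow> real ^ 'n ^ 'n" where
  "hessian f x = (\<chi> i j. partial_deriv i (partial_deriv j f) x)"

definition op_norm :: "real ^ 'n ^ 'm \<Rightarrow> real" where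
  "op_norm A = onorm (\<lambda>v. A *v v)"

definition hs_norm :: "real ^ 'n ^ 'm \<Rightarrow> real" where
  "hs_norm A = sqrt (\<Sum>i\<in>UNIV. \<Sum>j\<in>UNIV. (A $ i $ j)\<^sup>2)"

definition C1_on :: "(real ^ 'n) set \<Rightarrow> (real ^ 'n \<Rightarrow> real) \<Rightarrow> bool" where
  "C1_on G f \<longleftrightarrow>
     (\<forall>x\<in>G. f differentiable (at x)) \<and> (\<forall>i. continuous_on G (partial_deriv i f))"

definition C2_on :: "(real ^ 'n) set \<Rightarrow> (real ^ 'n \<Rightarrow> real) \<Rightarrow> bool" where
  "C2_on G f \<longleftrightarrow> C1_on G f \<and> (\<forall>i. C1_on G (partial_deriv i f))"

definition locally_lipschitz_on :: "(real ^ 'n) set \<Rightarrow> (real ^ 'n \<Rightarrow> real) \<Rightarrow> bool" where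
  "locally_lipschitz_on G u \<longleftrightarrow>
     (\<forall>x\<in>G. \<exists>r>0. \<exists>L. L-lipschitz_on (ball x r \<inter> G) u)"

text \<open>
  A locally Lipschitz function need not be differentiable everywhere, and the measure is not
  assumed to be absolutely continuous. At points of non-differentiability \<open>|\<nabla>u|\<close> is the local
  Lipschitz constant (the usual generalized modulus of the gradient). The lemma
  \<open>grad_norm_eq_local_lip\<close> shows that both notions agree at points of differentiability.
\<close>

definition local_lip :: "(real ^ 'n \<Rightarrow> real) \<Rightarrow> real ^ 'n \<Rightarrow> real" where
  "local_lip u x = real_of_ereal (Limsup (at x) (\<lambda>y. ereal (\<bar>u y - u x\<bar> / dist y x)))"

definition grad_norm :: "(real ^ 'n \<Rightarrow> real) \<Rightarrow> real ^ 'n \<Rightarrow> real" where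
  "grad_norm u x = (if u differentiable (at x) then norm (gradient u x) else local_lip u x)"

lemma has_derivative_gradient:
  assumes "u differentiable (at x)"
  shows "(u has_derivative (\<lambda>h. gradient u x \<bullet> h)) (at x)"
proof -
  obtain D where D: "(u has_derivative D) (at x)"
    using assms by (auto simp: differentiable_def)
  then interpret D: bounded_linear D by (rule has_derivative_bounded_linear)
  have grad: "partial_deriv i u x = D (axis i 1)" for i
  proof -
    have "((\<lambda>t. x + t *\<^sub>R axis i 1) has_derivative (\<lambda>t. t *\<^sub>R axis i 1)) (at (0::real))"
      by (auto intro!: derivative_eq_intros)
    then have "((\<lambda>t. u (x + t *\<^sub>R axis i 1)) has_derivative (\<lambda>t. D (t *\<^sub>R axis i 1))) (at (0::real))"
      by (rule has_derivative_compose) (use D in simp)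
    then have "((\<lambda>t. u (x + t *\<^sub>R axis i 1)) has_real_derivative D (axis i 1)) (at 0)"
      unfolding has_field_derivative_def by (simp add: D.scaleR mult_commute_abs)
    then show ?thesis
      unfolding partial_deriv_def by (rule DERIV_imp_deriv)
  qed
  have "D h = gradient u x \<bullet> h" for h
  proof -
    have "D h = D (\<Sum>i\<in>UNIV. (h $ i) *\<^sub>R axis i 1)"
      by (simp add: basis_expansion scalar_mult_eq_scaleR[symmetric])
    also have "\<dots> = (\<Sum>i\<in>UNIV. (h $ i) * D (axis i 1))"
      by (simp add: D.sum D.scaleR)
    also have "\<dots> = gradient u x \<bullet> h"
      by (simp add: inner_vec_def gradient_def grad mult.commute)
    finally show ?thesis .
  qed
  with D show ?thesis by (metis (no_types, lifting) ext)
qed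

lemma grad_norm_eq_local_lip: "grad_norm u x = local_lip u x"
proof (cases "u differentiable (at x)")
  case True
  define g where "g = gradient u x"
  define q where "q = (\<lambda>y. \<bar>u y - u x\<bar> / dist y x)"
  have "(u has_derivative (\<lambda>h. g \<bullet> h)) (at x)"
    using has_derivative_gradient[OF True] by (simp add: g_def)
  then have lim: "((\<lambda>y. (u y - u x - g \<bullet> (y - x)) /\<^sub>R norm (y - x)) \<longlongrightarrow> 0) (at x)"
    by (simp add: has_derivative_at_within)
  have ev: "\<forall>\<^sub>F y in at x. \<bar>\<bar>u y - u x\<bar> / dist y x - \<bar>g \<bullet> (y - x)\<bar> / dist y x\<bar> < e" if "e > 0" for e
  proof -
    have "\<forall>\<^sub>F y in at x. dist ((u y - u x - g \<bullet> (y - x)) /\<^sub>R norm (y - x)) 0 < e"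
      using lim that by (rule tendstoD)
    then show ?thesis
    proof eventually_elim
      case (elim y)
      have "\<bar>\<bar>u y - u x\<bar> / dist y x - \<bar>g \<bullet> (y - x)\<bar> / dist y x\<bar>
          = \<bar>\<bar>u y - u x\<bar> - \<bar>g \<bullet> (y - x)\<bar>\<bar> / dist y x"
        by (simp add: diff_divide_distrib[symmetric])
      also have "\<dots> \<le> \<bar>u y - u x - g \<bullet> (y - x)\<bar> / dist y x"
        by (intro divide_right_mono) auto
      also have "\<dots> < e"
        using elim by (simp add: dist_norm divide_inverse_commute abs_mult)
      finally show ?case .
    qed
  qed
  have "Limsup (at x) (\<lambda>y. ereal (q y)) = ereal (norm g)"
  proof (rule antisym)
    show "Limsup (at x) (\<lambda>y. ereal (q y)) \<le> ereal (norm g)"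
    proof (rule ereal_le_epsilon2)
      fix e :: real assume e: "0 < e"
      have "\<forall>\<^sub>F y in at x. ereal (q y) \<le> ereal (norm g + e)"
        using ev[OF e]
      proof eventually_elim
        case (elim y)
        have "\<bar>g \<bullet> (y - x)\<bar> / dist y x \<le> norm g"
          using Cauchy_Schwarz_ineq2[of g "y - x"]
          by (cases "y = x") (auto simp: dist_norm field_simps)
        with elim show ?case by (simp add: q_def)
      qed
      then have "Limsup (at x) (\<lambda>y. ereal (q y)) \<le> ereal (norm g + e)"
        by (rule Limsup_bounded)
      then show "Limsup (at x) (\<lambda>y. ereal (q y)) \<le> ereal (norm g) + ereal e" by simp
    qed
  next
    show "ereal (norm g) \<le> Limsup (at x) (\<lambda>y. ereal (q y))"
    proof (rule ereal_le_epsilon2)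
      fix e :: real assume e: "0 < e"
      obtain v :: "real ^ 'a" where v: "norm v = 1" "g \<bullet> v = norm g"
      proof (cases "g = 0")
        case True
        then show ?thesis using that[of "axis undefined 1"] by simp
      next
        case False
        then show ?thesis using that[of "g /\<^sub>R norm g"]
          by (simp add: dot_square_norm power2_eq_square)
      qed
      have flim: "filterlim (\<lambda>t. x + t *\<^sub>R v) (at x) (at_right (0::real))"
        unfolding filterlim_at
      proof
        show "\<forall>\<^sub>F t in at_right 0. x + t *\<^sub>R v \<in> UNIV \<and> x + t *\<^sub>R v \<noteq> x"
          using v by (intro eventually_at_rightI[of 0 1]) auto
        show "((\<lambda>t. x + t *\<^sub>R v) \<longlongrightarrow> x) (at_right 0)"
          by (auto intro!: tendsto_eq_intros)
      qed
      have "\<forall>\<^sub>F t in at_right 0. ereal (norm g - e) \<le> ereal (q (x + t *\<^sub>R v))"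
        using eventually_compose_filterlim[OF ev[OF e] flim] eventually_at_right_less[of 0]
      proof eventually_elim
        case (elim t)
        then show ?case using v by (simp add: q_def dist_norm abs_mult)
      qed
      then have "ereal (norm g - e) \<le> Liminf (at_right 0) (\<lambda>t. ereal (q (x + t *\<^sub>R v)))"
        by (rule Liminf_bounded)
      also have "\<dots> \<le> Limsup (at_right 0) (\<lambda>t. ereal (q (x + t *\<^sub>R v)))"
        by (rule Liminf_le_Limsup) simp
      also have "\<dots> \<le> Limsup (at x) (\<lambda>y. ereal (q y))"
      proof (subst (2) Limsup_def, rule INF_greatest)
        fix P assume "P \<in> {P. eventually P (at x)}"
        then have "\<forall>\<^sub>F t in at_right 0. P (x + t *\<^sub>R v)"
          using eventually_compose_filterlim[OF _ flim] by simp
        then have "\<forall>\<^sub>F t in at_right 0.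
            ereal (q (x + t *\<^sub>R v)) \<le> Sup ((\<lambda>y. ereal (q y)) ` Collect P)"
          by eventually_elim (auto intro: SUP_upper)
        then show "Limsup (at_right 0) (\<lambda>t. ereal (q (x + t *\<^sub>R v)))
            \<le> Sup ((\<lambda>y. ereal (q y)) ` Collect P)"
          by (rule Limsup_bounded)
      qed
      finally have "ereal (norm g - e) + ereal e \<le> Limsup (at x) (\<lambda>y. ereal (q y)) + ereal e"
        by (rule add_right_mono)
      then show "ereal (norm g) \<le> Limsup (at x) (\<lambda>y. ereal (q y)) + ereal e"
        by simp
    qed
  qed
  then show ?thesis using True by (simp add: grad_norm_def local_lip_def g_def q_def)
next
  case False
  then show ?thesis by (simp add: grad_norm_def)
qed

text \<open>Note that \<open>ln 0 = 0\<close>, so the convention \<open>0 log 0 = 0\<close> is built in.\<close>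

definition Ent :: "'a measure \<Rightarrow> ('a \<Rightarrow> real) \<Rightarrow> real" where
  "Ent M g = (LINT x|M. g x * ln (g x)) - (LINT x|M. g x) * ln (LINT x|M. g x)"

text \<open>
  The inequality \<open>Ent (u\<^sup>2) \<le> 2 s \<integral>|\<nabla>u|\<^sup>2\<close> is between extended reals: for \<open>u\<^sup>2 \<in> L\<^sup>1\<close>
  (otherwise the entropy is an undefined \<open>\<infinity> - \<infinity>\<close>) the left-hand side lies in \<open>[0, \<infinity>]\<close> and is
  infinite iff \<open>u\<^sup>2 log u\<^sup>2\<close> is not integrable. It is trivial if the right-hand side is infinite;
  otherwise it says that the entropy is finite and bounded by the right-hand side.
\<close>

definition log_sobolev :: "(real ^ 'n) set \<Rightarrow> (real ^ 'n) measure \<Rightarrow> real \<Rightarrow> bool" where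
  "log_sobolev G M s \<longleftrightarrow>
     (\<forall>u. locally_lipschitz_on G u \<longrightarrow>
        integrable M (\<lambda>x. (u x)\<^sup>2) \<longrightarrow> integrable M (\<lambda>x. (grad_norm u x)\<^sup>2) \<longrightarrow>
        integrable M (\<lambda>x. (u x)\<^sup>2 * ln ((u x)\<^sup>2)) \<and>
        Ent M (\<lambda>x. (u x)\<^sup>2) \<le> 2 * s * (LINT x|M. (grad_norm u x)\<^sup>2))"

end

theory Submission
  imports Defs
begin

text \<open>
  Write \<open>s = \<sigma>\<^sup>2\<close>, \<open>B = b\<^sup>2\<close> and \<open>h = |\<nabla>f|\<^sup>2\<close>. The bound on the Hessian enters twice: in operator norm
  it makes \<open>h\<close> self-bounding, \<open>|\<nabla>h| = 2 |f'' \<nabla>f| \<le> 2 \<surd>h\<close>, and in Hilbert-Schmidt norm it controls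
  the mean of \<open>h\<close>.

  A logarithmic Sobolev inequality applied to \<open>e\<^bsup>tW/2\<^esup>\<close> bounds \<open>Ent (e\<^bsup>tW\<^esup>)\<close> by
  \<open>(s/2) t\<^sup>2 \<integral> |\<nabla>W|\<^sup>2 e\<^bsup>tW\<^esup>\<close> (\<open>Ent_exp_le\<close>), and the Herbst argument (\<open>herbst\<close>) turns a bound on
  \<open>Ent (e\<^bsup>tW\<^esup>)\<close> for \<open>0 < t \<le> L\<close> into a bound on \<open>\<integral> e\<^bsup>LW\<^esup>\<close>, since the derivative of
  \<open>(1/t) log \<integral> e\<^bsup>tW\<^esup>\<close> is \<open>Ent (e\<^bsup>tW\<^esup>) / (t\<^sup>2 \<integral> e\<^bsup>tW\<^esup>)\<close>. This is used three times.

  \<^item> For \<open>W = \<partial>\<^sub>i f\<close> and \<open>t \<rightarrow> 0\<close> it yields the Poincare inequality \<open>\<integral> (\<partial>\<^sub>i f)\<^sup>2 \<le> s \<integral> |\<nabla>\<partial>\<^sub>i f|\<^sup>2\<close>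
    (\<open>poincare\<close>); summing over \<open>i\<close> gives \<open>\<integral> h \<le> s B\<close> (\<open>expectation_sq_gradient_le\<close>).
  \<^item> For \<open>W = h\<close> the self-bounding property gives
    \<open>\<integral> e\<^bsup>lh\<^esup> \<le> exp (l \<integral> h / (1 - 2 s l))\<close> if \<open>2 s l < 1\<close> (\<open>exp_self_bounding\<close>).
  \<^item> For \<open>W = f\<close> the variational formula for the entropy (\<open>expectation_mult_exp_le_Ent\<close>) bounds
    \<open>\<integral> s t\<^sup>2 h e\<^bsup>tf\<^esup>\<close> by \<open>Ent (e\<^bsup>tf\<^esup>)\<close> plus \<open>\<integral> e\<^bsup>tf\<^esup>\<close> times the logarithm of \<open>\<integral> e\<^bsup>s t\<^sup>2 h\<^esup>\<close>. As
    \<open>2 Ent (e\<^bsup>tf\<^esup>)\<close> is at most the left-hand side, one copy of the entropy is absorbed and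
    \<open>\<integral> e\<^bsup>Lf\<^esup> \<le> exp (s L\<^sup>2 \<integral> h / (1 - 2 s\<^sup>2 L\<^sup>2))\<close> follows (\<open>exp_le_expectation_sq_gradient\<close>).

  Let \<open>c = 1 / (2 s (1 + B))\<close>. The last bound for \<open>f\<close> and \<open>-f\<close> at \<open>L = 4c/3\<close>, rather than at \<open>c\<close>
  itself, gives \<open>\<integral> e\<^bsup>L|f|\<^esup> \<le> 2\<^bsup>4/3\<^esup>\<close>. The factor 2 from adding the two signs is then removed by
  taking the power 3/4 (\<open>nn_integral_exp_abs_le_2\<close>).

  All exponential moments are first computed for bounded smooth truncations and then passed to
  the limit with Fatou's lemma. The truncation \<open>k arctan (y/k)\<close> stays within the continuously
  differentiable functions, does not increase gradients and preserves the self-bounding property.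
\<close>

section \<open>Inequalities for the exponential function and the arctangent\<close>

lemma exp_minus_one_le:
  fixes z :: real
  shows "exp z - 1 \<le> z * exp z"
proof -
  have "(1 - z) * exp z \<le> exp (- z) * exp z"
    using exp_ge_add_one_self[of "- z"] by (intro mult_right_mono) auto
  then show ?thesis by (simp add: exp_minus algebra_simps)
qed

text \<open>
  The second-order Taylor remainder, in a form that is uniform in the sign of \<open>z\<close>; it
  dominates difference quotients of moment generating functions.
\<close>

lemma exp_remainder_bound:
  fixes z :: real
  shows "\<bar>exp z - 1 - z\<bar> \<le> z\<^sup>2 * exp \<bar>z\<bar>"
proof -
  have lo: "1 + z \<le> exp z" by (rule exp_ge_add_one_self)
  have up: "exp z - 1 \<le> z * exp z" by (rule exp_minus_one_le)
  have "z * (exp z - 1) \<le> z * (z * exp \<bar>z\<bar>)"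
  proof (cases "z \<ge> 0")
    case True
    then show ?thesis using up by (intro mult_left_mono) auto
  next
    case False
    have "z * exp \<bar>z\<bar> \<le> z * 1" using False by (intro mult_left_mono_neg) auto
    with lo have "z * exp \<bar>z\<bar> \<le> exp z - 1" by linarith
    with False show ?thesis by (intro mult_left_mono_neg) auto
  qed
  with lo up show ?thesis by (simp add: power2_eq_square algebra_simps)
qed

text \<open>
  The Taylor polynomial of odd degree is a lower bound on the whole line because the remainder
  has even degree.
\<close>

lemma exp_ge_cubic:
  fixes y :: real
  shows "1 + y + y\<^sup>2 / 2 + y ^ 3 / 6 \<le> exp y"
proof -
  obtain t where "exp y = (\<Sum>m<4. y ^ m / fact m) + exp t / fact 4 * y ^ 4"
    using Maclaurin_exp_le[of y 4] by blast
  moreover have "(\<Sum>m<4. y ^ m / fact m) = 1 + y + y\<^sup>2 / 2 + y ^ 3 / 6"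
    by (simp add: eval_nat_numeral)
  ultimately show ?thesis by simp
qed

text \<open>
  The tangent line of \<open>a\<^bsup>3/4\<^esup>\<close> at \<open>a = 1\<close>, with \<open>a = exp z\<close>.
\<close>

lemma exp_three_quarters_le:
  fixes z :: real
  shows "exp (3 / 4 * z) \<le> 1 / 4 + 3 / 4 * exp z"
proof -
  define w where "w = exp (z / 4)"
  have "w > 0" by (simp add: w_def)
  \<comment> \<open>In terms of \<open>w = exp (z / 4)\<close> the claim is a polynomial inequality with a double root at 1.\<close>
  have "0 \<le> (w - 1)\<^sup>2 * (3 * w\<^sup>2 + 2 * w + 1)"
    using \<open>w > 0\<close> by (intro mult_nonneg_nonneg) auto
  also have "\<dots> = 3 * w ^ 4 - 4 * w ^ 3 + 1" by algebra
  finally have "w ^ 3 \<le> 1 / 4 + 3 / 4 * w ^ 4" by simp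
  moreover have "w ^ 3 = exp (3 / 4 * z)" "w ^ 4 = exp z"
    by (simp_all add: w_def exp_of_nat_mult[symmetric])
  ultimately show ?thesis by simp
qed

lemma arctan_ge_rational:
  assumes "0 \<le> z"
  shows "z / (1 + z\<^sup>2) \<le> arctan z"
proof (cases "z = 0")
  case False
  with assms have "0 < z" by simp
  then obtain w where w: "0 < w" "w < z" "arctan z - arctan 0 = (z - 0) * inverse (1 + w\<^sup>2)"
    using MVT2[of 0 z arctan "\<lambda>w. inverse (1 + w\<^sup>2)"] DERIV_arctan by blast
  have "inverse (1 + z\<^sup>2) \<le> inverse (1 + w\<^sup>2)"
    using w by (intro le_imp_inverse_le add_left_mono power_mono add_pos_nonneg) auto
  then have "z * inverse (1 + z\<^sup>2) \<le> z * inverse (1 + w\<^sup>2)"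
    using assms by (rule mult_left_mono)
  with w show ?thesis by (simp add: divide_inverse)
qed simp

section \<open>Gradients of continuously differentiable functions\<close>

lemma gradient_eqI:
  assumes "(u has_derivative (\<lambda>h. g \<bullet> h)) (at x)"
  shows "gradient u x = g"
proof -
  have "u differentiable (at x)" using assms by (auto simp: differentiable_def)
  from has_derivative_unique[OF has_derivative_gradient[OF this] assms]
  have "gradient u x \<bullet> h = g \<bullet> h" for h by meson
  then show ?thesis using vector_eq_rdot by blast
qed

lemma continuous_on_gradient:
  assumes "C1_on G u"
  shows "continuous_on G (gradient u)"
  using assms unfolding C1_on_def gradient_def by (intro continuous_intros) simp

lemma C1_on_has_derivative:
  assumes "C1_on G u" "x \<in> G"
  shows "(u has_derivative (\<lambda>h. gradient u x \<bullet> h)) (at x)"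
  using assms by (auto simp: C1_on_def intro: has_derivative_gradient)

lemma C1_onI:
  assumes "\<And>x. x \<in> G \<Longrightarrow> (u has_derivative (\<lambda>h. g x \<bullet> h)) (at x)"
    and "continuous_on G g"
  shows "C1_on G u"
  unfolding C1_on_def
proof (intro conjI ballI allI)
  show "u differentiable (at x)" if "x \<in> G" for x
    using assms(1)[OF that] by (auto simp: differentiable_def)
  show "continuous_on G (partial_deriv i u)" for i
  proof -
    have "continuous_on G (\<lambda>x. g x $ i)"
      using assms(2) by (intro continuous_intros)
    moreover have "partial_deriv i u x = g x $ i" if "x \<in> G" for x
      using gradient_eqI[OF assms(1)[OF that]] by (simp add: gradient_def vec_eq_iff)
    ultimately show ?thesis using continuous_on_cong[of G G "partial_deriv i u"] by simp
  qed
qed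

lemma C1_on_imp_continuous_on: "C1_on G u \<Longrightarrow> continuous_on G u"
  unfolding C1_on_def
  by (intro continuous_at_imp_continuous_on ballI differentiable_imp_continuous_within) blast

text \<open>
  The chain rule for an outer function that is smooth on the whole line; the cases of interest are
  exponentials, truncations and negation.
\<close>

lemma C1_on_chain:
  assumes "C1_on G p" "\<And>y. (T has_real_derivative T' y) (at y)" "continuous_on UNIV T'"
  shows "C1_on G (\<lambda>x. T (p x))"
    and "x \<in> G \<Longrightarrow> gradient (\<lambda>x. T (p x)) x = T' (p x) *\<^sub>R gradient p x"
proof -
  have d: "((\<lambda>x. T (p x)) has_derivative (\<lambda>h. (T' (p x) *\<^sub>R gradient p x) \<bullet> h)) (at x)"
    if "x \<in> G" for x
    using has_derivative_compose[OF C1_on_has_derivative[OF assms(1) that]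
        assms(2)[unfolded has_field_derivative_def]]
    by simp
  show "C1_on G (\<lambda>x. T (p x))"
  proof (rule C1_onI[OF d])
    show "continuous_on G (\<lambda>x. T' (p x) *\<^sub>R gradient p x)"
      using assms(1,3) continuous_on_compose2[OF assms(3) C1_on_imp_continuous_on[OF assms(1)]]
      by (intro continuous_intros continuous_on_gradient) auto
  qed
  show "x \<in> G \<Longrightarrow> gradient (\<lambda>x. T (p x)) x = T' (p x) *\<^sub>R gradient p x"
    by (rule gradient_eqI[OF d])
qed

text \<open>
  This makes continuously differentiable functions admissible in the logarithmic Sobolev
  inequality. The gradient is bounded on a small closed ball by compactness, and the mean value
  inequality applies on the ball since it is convex.
\<close>

lemma C1_on_imp_locally_lipschitz_on:
  assumes "open G" "C1_on G u"
  shows "locally_lipschitz_on G u"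
  unfolding locally_lipschitz_on_def
proof
  fix x assume "x \<in> G"
  with \<open>open G\<close> obtain r where r: "r > 0" "cball x r \<subseteq> G"
    unfolding open_contains_cball by blast
  have "continuous_on (cball x r) (\<lambda>y. norm (gradient u y))"
    by (intro continuous_intros continuous_on_subset[OF continuous_on_gradient[OF assms(2)] r(2)])
  then have "compact ((\<lambda>y. norm (gradient u y)) ` cball x r)"
    by (rule compact_continuous_image) simp
  then have "bounded ((\<lambda>y. norm (gradient u y)) ` cball x r)"
    by (rule compact_imp_bounded)
  then obtain L where L: "\<And>y. y \<in> cball x r \<Longrightarrow> norm (gradient u y) \<le> L"
    unfolding bounded_iff by (metis imageI abs_norm_cancel real_norm_def)
  have "L-lipschitz_on (ball x r \<inter> G) u"
  proof (rule lipschitz_onI)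
    fix y z assume yz: "y \<in> ball x r \<inter> G" "z \<in> ball x r \<inter> G"
    have "norm (u y - u z) \<le> L * norm (y - z)"
    proof (rule differentiable_bound[where S = "ball x r" and f' = "\<lambda>w h. gradient u w \<bullet> h"])
      fix w assume w: "w \<in> ball x r"
      have "w \<in> G" by (rule subsetD[OF r(2)]) (use w in simp)
      then show "(u has_derivative (\<lambda>h. gradient u w \<bullet> h)) (at w within ball x r)"
        by (rule has_derivative_at_withinI[OF C1_on_has_derivative[OF assms(2)]])
      show "onorm (\<lambda>h. gradient u w \<bullet> h) \<le> L"
      proof (rule onorm_le)
        fix h :: "real ^ 'a"
        have "norm (gradient u w \<bullet> h) \<le> norm (gradient u w) * norm h"
          using Cauchy_Schwarz_ineq2 by simp
        also have "\<dots> \<le> L * norm h" using w by (intro mult_right_mono L) auto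
        finally show "norm (gradient u w \<bullet> h) \<le> L * norm h" .
      qed
    qed (use yz in auto)
    then show "dist (u y) (u z) \<le> L * dist y z" by (simp add: dist_norm)
  next
    show "0 \<le> L" using order_trans[OF norm_ge_zero L[of x]] r by simp
  qed
  with r show "\<exists>r>0. \<exists>L. L-lipschitz_on (ball x r \<inter> G) u" by blast
qed

text \<open>
  The product rule for \<open>|\<nabla>f|\<^sup>2 = (\<Sum>i. (\<partial>\<^sub>i f)\<^sup>2)\<close>, read off with
  \<open>hessian f x $ j $ i = \<partial>\<^sub>j \<partial>\<^sub>i f x\<close>.
\<close>

lemma gradient_sq_norm_gradient:
  assumes "C2_on G f"
  shows "C1_on G (\<lambda>x. (norm (gradient f x))\<^sup>2)"
    and "x \<in> G \<Longrightarrow> gradient (\<lambda>x. (norm (gradient f x))\<^sup>2) x = 2 *\<^sub>R (hessian f x *v gradient f x)"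
proof -
  have C1: "C1_on G (partial_deriv i f)" for i using assms by (simp add: C2_on_def)
  have sq: "(norm (gradient f x))\<^sup>2 = (\<Sum>i\<in>UNIV. (partial_deriv i f x)\<^sup>2)" for x
    by (simp add: norm_vec_def L2_set_def gradient_def sum_nonneg)
  have d: "((\<lambda>x. (norm (gradient f x))\<^sup>2) has_derivative
      (\<lambda>h. (2 *\<^sub>R (hessian f x *v gradient f x)) \<bullet> h)) (at x)" if "x \<in> G" for x
  proof -
    have "((\<lambda>x. \<Sum>i\<in>UNIV. (partial_deriv i f x)\<^sup>2) has_derivative
        (\<lambda>h. \<Sum>i\<in>UNIV. 2 * partial_deriv i f x * (gradient (partial_deriv i f) x \<bullet> h))) (at x)"
      by (intro has_derivative_sum) (auto intro!: derivative_eq_intros C1_on_has_derivative[OF C1 that])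
    moreover have "(\<Sum>i\<in>UNIV. 2 * partial_deriv i f x * (gradient (partial_deriv i f) x \<bullet> h))
        = (2 *\<^sub>R (hessian f x *v gradient f x)) \<bullet> h" for h
    proof -
      have "(\<Sum>i\<in>UNIV. 2 * partial_deriv i f x * (gradient (partial_deriv i f) x \<bullet> h))
         = (\<Sum>i\<in>UNIV. \<Sum>j\<in>UNIV. 2 * partial_deriv i f x * (partial_deriv j (partial_deriv i f) x * h $ j))"
        by (simp add: inner_vec_def gradient_def sum_distrib_left)
      also have "\<dots> = (\<Sum>j\<in>UNIV. \<Sum>i\<in>UNIV. 2 * partial_deriv i f x * (partial_deriv j (partial_deriv i f) x * h $ j))"
        by (rule sum.swap)
      also have "\<dots> = (2 *\<^sub>R (hessian f x *v gradient f x)) \<bullet> h"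
        by (simp add: inner_vec_def gradient_def hessian_def matrix_vector_mult_def
            sum_distrib_left sum_distrib_right mult_ac)
      finally show ?thesis .
    qed
    ultimately show ?thesis by (simp add: sq[abs_def])
  qed
  show "C1_on G (\<lambda>x. (norm (gradient f x))\<^sup>2)"
  proof (rule C1_onI[OF d])
    have "continuous_on G (partial_deriv j (partial_deriv i f))" for i j
      using C1 by (simp add: C1_on_def)
    then show "continuous_on G (\<lambda>x. 2 *\<^sub>R (hessian f x *v gradient f x))"
      using C1_on_imp_continuous_on[OF C1]
      unfolding matrix_vector_mult_def hessian_def gradient_def
      by (auto intro!: continuous_intros)
  qed
  show "x \<in> G \<Longrightarrow> gradient (\<lambda>x. (norm (gradient f x))\<^sup>2) x = 2 *\<^sub>R (hessian f x *v gradient f x)"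
    by (rule gradient_eqI[OF d])
qed

section \<open>Smooth truncation\<close>

text \<open>
  For \<open>k > 0\<close> a bounded, odd and strictly increasing function with derivative in \<open>(0, 1]\<close> that tends to the
  identity as \<open>k \<rightarrow> \<infinity>\<close>.
\<close>

definition trunc :: "real \<Rightarrow> real \<Rightarrow> real" where
  "trunc k y = k * arctan (y / k)"

lemma DERIV_trunc:
  assumes "k > 0"
  shows "(trunc k has_real_derivative 1 / (1 + (y / k)\<^sup>2)) (at y)"
  unfolding trunc_def[abs_def] using assms
  by (auto intro!: derivative_eq_intros simp: inverse_eq_divide)

lemma abs_trunc_le: "k > 0 \<Longrightarrow> \<bar>trunc k y\<bar> \<le> \<bar>y\<bar>"
  using abs_arctan_le[of "y / k"] by (simp add: trunc_def abs_mult field_simps)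

lemma abs_trunc_bounded: "k > 0 \<Longrightarrow> \<bar>trunc k y\<bar> \<le> 2 * k"
  using arctan_bounded[of "y / k"] pi_less_4 by (auto simp: trunc_def abs_mult)

text \<open>
  The left-hand side is \<open>y\<close> times the derivative of the truncation at \<open>y\<close>. So truncating a function
  \<open>h \<ge> 0\<close> with \<open>|\<nabla>h|\<^sup>2 \<le> 4 h\<close> preserves this inequality.
\<close>

lemma trunc_ge:
  assumes "k > 0" "0 \<le> y"
  shows "y / (1 + (y / k)\<^sup>2) \<le> trunc k y"
  using mult_left_mono[OF arctan_ge_rational[of "y / k"], of k] assms by (simp add: trunc_def)

lemma trunc_minus: "trunc k (- y) = - trunc k y"
  by (simp add: trunc_def arctan_minus)

lemma trunc_tendsto: "(\<lambda>k. trunc (real (Suc k)) y) \<longlonglongrightarrow> y"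
proof -
  have pos: "(\<lambda>k. trunc (real (Suc k)) y) \<longlonglongrightarrow> y" if y: "0 \<le> y" for y
  proof (rule tendsto_sandwich)
    show "\<forall>\<^sub>F k in sequentially. y / (1 + (y / real (Suc k))\<^sup>2) \<le> trunc (real (Suc k)) y"
      using y by (intro always_eventually allI trunc_ge) auto
    show "\<forall>\<^sub>F k in sequentially. trunc (real (Suc k)) y \<le> y"
      using y abs_trunc_le[of "real (Suc k)" y for k]
      by (intro always_eventually allI) (smt (verit) of_nat_0_less_iff zero_less_Suc)
    have "(\<lambda>k. y / real (Suc k)) \<longlonglongrightarrow> 0"
      by (rule LIMSEQ_Suc[OF lim_const_over_n])
    from tendsto_divide[OF tendsto_const[of y] tendsto_add[OF tendsto_const[of 1] tendsto_power[OF this, of 2]]]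
    show "(\<lambda>k. y / (1 + (y / real (Suc k))\<^sup>2)) \<longlonglongrightarrow> y" by simp
  qed simp
  show ?thesis
  proof (cases "0 \<le> y")
    case False
    from tendsto_minus[OF pos[of "- y"]] False show ?thesis by (simp add: trunc_minus)
  qed (rule pos)
qed

lemma C1_on_trunc:
  assumes "C1_on G p" "k > 0"
  shows "C1_on G (\<lambda>x. trunc k (p x))"
    and "x \<in> G \<Longrightarrow> gradient (\<lambda>x. trunc k (p x)) x = (1 / (1 + (p x / k)\<^sup>2)) *\<^sub>R gradient p x"
proof -
  have "continuous_on UNIV (\<lambda>y. 1 / (1 + (y / k)\<^sup>2))"
    using assms(2) by (intro continuous_intros) (auto simp: add_nonneg_eq_0_iff)
  note * = C1_on_chain[OF assms(1) DERIV_trunc[OF assms(2)] this]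
  show "C1_on G (\<lambda>x. trunc k (p x))" by (rule *(1))
  show "x \<in> G \<Longrightarrow> gradient (\<lambda>x. trunc k (p x)) x = (1 / (1 + (p x / k)\<^sup>2)) *\<^sub>R gradient p x"
    by (rule *(2))
qed

text \<open>
  The gradient picks up a factor \<open>c \<in> (0, 1]\<close>. The first bound keeps one of the two factors in
  \<open>c\<^sup>2\<close>, as needed together with \<open>trunc_ge\<close>.
\<close>

lemma norm_gradient_trunc_le:
  assumes "C1_on G p" "k > 0" "x \<in> G"
  shows "(norm (gradient (\<lambda>x. trunc k (p x)) x))\<^sup>2 \<le> 1 / (1 + (p x / k)\<^sup>2) * (norm (gradient p x))\<^sup>2"
    and "(norm (gradient (\<lambda>x. trunc k (p x)) x))\<^sup>2 \<le> (norm (gradient p x))\<^sup>2"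
proof -
  define c where "c = 1 / (1 + (p x / k)\<^sup>2)"
  have c: "0 \<le> c" "c \<le> 1" by (auto simp: c_def divide_le_eq_1 add_pos_nonneg)
  have eq: "(norm (gradient (\<lambda>x. trunc k (p x)) x))\<^sup>2 = c * (c * (norm (gradient p x))\<^sup>2)"
  proof -
    have "gradient (\<lambda>x. trunc k (p x)) x = c *\<^sub>R gradient p x"
      unfolding c_def by (rule C1_on_trunc(2)[OF assms])
    then show ?thesis using c by (simp add: power2_eq_square)
  qed
  have "c * (norm (gradient p x))\<^sup>2 \<le> 1 * (norm (gradient p x))\<^sup>2"
    using c by (intro mult_right_mono) auto
  with mult_left_mono[OF this c(1)]
  show "(norm (gradient (\<lambda>x. trunc k (p x)) x))\<^sup>2 \<le> 1 / (1 + (p x / k)\<^sup>2) * (norm (gradient p x))\<^sup>2"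
    and "(norm (gradient (\<lambda>x. trunc k (p x)) x))\<^sup>2 \<le> (norm (gradient p x))\<^sup>2"
    unfolding eq c_def[symmetric] by simp_all
qed

section \<open>Moment generating functions of bounded random variables\<close>

text \<open>
  Fatou's lemma in the form used for removing truncations.
\<close>

lemma nn_integral_le_tendsto:
  fixes u :: "nat \<Rightarrow> 'a \<Rightarrow> ennreal"
  assumes "\<And>k. u k \<in> borel_measurable M"
    and "\<And>x. x \<in> space M \<Longrightarrow> (\<lambda>k. u k x) \<longlonglongrightarrow> v x"
    and "\<And>k. (\<integral>\<^sup>+ x. u k x \<partial>M) \<le> C k" and "C \<longlonglongrightarrow> c"
  shows "(\<integral>\<^sup>+ x. v x \<partial>M) \<le> c"
proof -
  have "(\<integral>\<^sup>+ x. v x \<partial>M) = (\<integral>\<^sup>+ x. liminf (\<lambda>k. u k x) \<partial>M)"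
    by (rule nn_integral_cong) (metis assms(2) lim_imp_Liminf trivial_limit_sequentially)
  also have "\<dots> \<le> liminf (\<lambda>k. \<integral>\<^sup>+ x. u k x \<partial>M)"
    by (rule nn_integral_liminf) (rule assms(1))
  also have "\<dots> \<le> liminf C"
    by (rule Liminf_mono) (simp add: assms(3))
  also have "\<dots> = c"
    using lim_imp_Liminf[OF trivial_limit_sequentially assms(4)] .
  finally show ?thesis .
qed

lemma nn_integral_le_imp_integral_le:
  fixes u :: "'a \<Rightarrow> real"
  assumes "u \<in> borel_measurable M" "\<And>x. 0 \<le> u x" "0 \<le> c" "(\<integral>\<^sup>+ x. ennreal (u x) \<partial>M) \<le> ennreal c"
  shows "integrable M u" and "integral\<^sup>L M u \<le> c"
proof -
  show int: "integrable M u"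
    using assms le_less_trans[OF assms(4) ennreal_less_top] by (intro integrableI_nonneg) auto
  show "integral\<^sup>L M u \<le> c"
    using assms nn_integral_eq_integral[OF int] by simp
qed

context prob_space
begin

abbreviation mgf :: "('a \<Rightarrow> real) \<Rightarrow> real \<Rightarrow> real" where
  "mgf W t \<equiv> expectation (\<lambda>x. exp (t * W x))"

lemma integrable_mult_exp:
  fixes V W :: "'a \<Rightarrow> real"
  assumes "integrable M V" and [measurable]: "W \<in> borel_measurable M"
    and "\<And>x. x \<in> space M \<Longrightarrow> \<bar>W x\<bar> \<le> N"
  shows "integrable M (\<lambda>x. V x * exp (t * W x))"
proof (rule Bochner_Integration.integrable_bound)
  show "integrable M (\<lambda>x. V x * exp (\<bar>t\<bar> * N))" using assms(1) by simp
  show "(\<lambda>x. V x * exp (t * W x)) \<in> borel_measurable M" using assms(1) by measurable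
  have "t * W x \<le> \<bar>t\<bar> * N" if "x \<in> space M" for x
    using abs_le_D1[of "t * W x"] mult_left_mono[OF assms(3)[OF that], of "\<bar>t\<bar>"]
    by (simp add: abs_mult)
  then show "AE x in M. norm (V x * exp (t * W x)) \<le> norm (V x * exp (\<bar>t\<bar> * N))"
    by (intro AE_I2) (simp add: abs_mult mult_left_mono)
qed

lemma mgf_pos:
  assumes "W \<in> borel_measurable M" "\<And>x. x \<in> space M \<Longrightarrow> \<bar>W x\<bar> \<le> N"
  shows "0 < mgf W t"
proof -
  have "integrable M (\<lambda>x. exp (t * W x))"
    using integrable_mult_exp[OF _ assms, of "\<lambda>_. 1" t] by simp
  then have "mgf W t \<noteq> 0"
    using integral_nonneg_eq_0_iff_AE[of M "\<lambda>x. exp (t * W x)"] by (auto simp: AE_False)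
  moreover have "mgf W t \<ge> 0" by (rule Bochner_Integration.integral_nonneg) simp
  ultimately show ?thesis by linarith
qed

text \<open>
  Differentiation under the integral sign; as \<open>W\<close> is bounded, the Taylor remainder is of order
  \<open>h\<^sup>2\<close> uniformly.
\<close>

lemma DERIV_mgf:
  assumes W: "W \<in> borel_measurable M" and bound: "\<And>x. x \<in> space M \<Longrightarrow> \<bar>W x\<bar> \<le> N"
  shows "(mgf W has_real_derivative expectation (\<lambda>x. W x * exp (t * W x))) (at t)"
proof -
  define D where "D = expectation (\<lambda>x. W x * exp (t * W x))"
  have iW: "integrable M W" using W bound by (intro integrable_const_bound[of _ N]) auto
  have ie: "integrable M (\<lambda>x. exp (r * W x))" for r
    using integrable_mult_exp[OF _ assms, of "\<lambda>_. 1" r] by simp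
  have iWe: "integrable M (\<lambda>x. W x * exp (t * W x))"
    by (rule integrable_mult_exp[OF iW assms])
  have iQ: "integrable M (\<lambda>x. (exp N * (W x)\<^sup>2) * exp (t * W x))"
    using W power_mono[OF bound, of _ 2]
    by (intro integrable_mult_exp[OF _ assms] integrable_mult_right integrable_const_bound[of _ "N\<^sup>2"]) auto
  define C where "C = expectation (\<lambda>x. (exp N * (W x)\<^sup>2) * exp (t * W x))"
  have key: "\<bar>mgf W (t + h) - mgf W t - h * D\<bar> \<le> h\<^sup>2 * C" if "\<bar>h\<bar> \<le> 1" for h
  proof -
    have "\<bar>mgf W (t + h) - mgf W t - h * D\<bar>
        = \<bar>expectation (\<lambda>x. exp ((t + h) * W x) - exp (t * W x) - h * (W x * exp (t * W x)))\<bar>"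
      unfolding D_def by (simp add: ie iWe)
    also have "\<dots> \<le> expectation (\<lambda>x. \<bar>exp ((t + h) * W x) - exp (t * W x) - h * (W x * exp (t * W x))\<bar>)"
      by (rule integral_abs_bound)
    also have "\<dots> \<le> expectation (\<lambda>x. h\<^sup>2 * ((exp N * (W x)\<^sup>2) * exp (t * W x)))"
    proof (rule integral_mono)
      fix x assume x: "x \<in> space M"
      have "\<bar>h * W x\<bar> \<le> 1 * N"
        unfolding abs_mult using that bound[OF x] by (intro mult_mono) auto
      then have "exp \<bar>h * W x\<bar> \<le> exp N" by simp
      then have "\<bar>exp (h * W x) - 1 - h * W x\<bar> \<le> (h * W x)\<^sup>2 * exp N"
        by (intro order_trans[OF exp_remainder_bound] mult_left_mono) auto
      from mult_right_mono[OF this, of "exp (t * W x)"]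
      have "\<bar>(exp (h * W x) - 1 - h * W x) * exp (t * W x)\<bar> \<le> (h * W x)\<^sup>2 * exp N * exp (t * W x)"
        by (simp add: abs_mult)
      then show "\<bar>exp ((t + h) * W x) - exp (t * W x) - h * (W x * exp (t * W x))\<bar>
          \<le> h\<^sup>2 * ((exp N * (W x)\<^sup>2) * exp (t * W x))"
        by (simp add: exp_add algebra_simps power_mult_distrib)
    qed (use ie iWe iQ in \<open>auto intro!: integrable_mult_right integrable_abs Bochner_Integration.integrable_diff\<close>)
    also have "\<dots> = h\<^sup>2 * C" unfolding C_def by simp
    finally show ?thesis .
  qed
  have "((\<lambda>h. (mgf W (t + h) - mgf W t) / h - D) \<longlongrightarrow> 0) (at 0)"
  proof (rule Lim_null_comparison)
    have "\<forall>\<^sub>F h in at (0::real). h \<in> {-1<..<1} \<and> h \<noteq> 0"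
      by (intro eventually_conj eventually_at_in_open' eventually_neq_at_within) auto
    then show "\<forall>\<^sub>F h in at 0. norm ((mgf W (t + h) - mgf W t) / h - D) \<le> \<bar>h\<bar> * C"
    proof eventually_elim
      case (elim h)
      then have "\<bar>mgf W (t + h) - mgf W t - h * D\<bar> / \<bar>h\<bar> \<le> h\<^sup>2 * C / \<bar>h\<bar>"
        by (intro divide_right_mono key) auto
      moreover have "(mgf W (t + h) - mgf W t) / h - D = (mgf W (t + h) - mgf W t - h * D) / h"
        using elim by (simp add: field_simps)
      moreover have "h\<^sup>2 * C / \<bar>h\<bar> = \<bar>h\<bar> * C"
        using elim by (simp add: power2_eq_square abs_if)
      ultimately show ?case by simp
    qed
    show "((\<lambda>h. \<bar>h\<bar> * C) \<longlongrightarrow> 0) (at (0::real))" by (auto intro!: tendsto_eq_intros)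
  qed
  then have "((\<lambda>h. (mgf W (t + h) - mgf W t) / h) \<longlongrightarrow> D) (at 0)"
    by (rule LIM_zero_cancel)
  then show ?thesis
    unfolding DERIV_def D_def .
qed

lemma Ent_exp:
  "Ent M (\<lambda>x. exp (t * W x)) = t * expectation (\<lambda>x. W x * exp (t * W x)) - mgf W t * ln (mgf W t)"
proof -
  have "(\<lambda>x. exp (t * W x) * ln (exp (t * W x))) = (\<lambda>x. t * (W x * exp (t * W x)))"
    by (simp add: mult_ac)
  then show ?thesis by (simp add: Ent_def)
qed

text \<open>
  The Herbst argument with a self-bounding term. Put \<open>\<psi> t = ln (mgf W t)\<close>. The hypothesis says
  \<open>t (1 - a t) \<psi>' t - \<psi> t \<le> K t\<^sup>2\<close>, that is, \<open>Q t = \<psi> t (1/t - a) - K t\<close> has a nonpositive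
  derivative. Since \<open>Q t \<rightarrow> \<psi>' 0 = expectation W\<close> as \<open>t \<rightarrow> 0\<close>, it follows that
  \<open>Q L \<le> expectation W\<close>. The case \<open>a = 0\<close> is the classical one.
\<close>

lemma herbst:
  assumes W: "W \<in> borel_measurable M" and bound: "\<And>x. x \<in> space M \<Longrightarrow> \<bar>W x\<bar> \<le> N"
    and "L > 0"
    and ent: "\<And>t. 0 < t \<Longrightarrow> t \<le> L \<Longrightarrow> Ent M (\<lambda>x. exp (t * W x))
        \<le> t\<^sup>2 * (a * expectation (\<lambda>x. W x * exp (t * W x)) + K * mgf W t)"
  shows "(1 - a * L) * ln (mgf W L) \<le> L * (expectation W + K * L)"
proof -
  define D where "D t = expectation (\<lambda>x. W x * exp (t * W x))" for t
  have pos: "mgf W t > 0" for t by (rule mgf_pos[OF W bound])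
  have dln: "((\<lambda>t. ln (mgf W t)) has_real_derivative D t / mgf W t) (at t)" for t
    unfolding D_def using pos[of t] DERIV_mgf[OF W bound, of t]
    by (auto intro!: derivative_eq_intros)
  define Q where "Q t = ln (mgf W t) * (1 / t - a) - K * t" for t
  have decr: "Q L \<le> Q t" if t: "0 < t" "t \<le> L" for t
  proof (rule DERIV_nonpos_imp_nonincreasing[OF t(2)], intro exI conjI)
    fix r assume r: "t \<le> r" "r \<le> L"
    with t have "r > 0" by simp
    let ?d = "D r / mgf W r * (1 / r - a) + - 1 / r\<^sup>2 * ln (mgf W r) - K"
    have "((\<lambda>r. 1 / r - a) has_real_derivative - 1 / r\<^sup>2) (at r)"
      using \<open>r > 0\<close> by (auto intro!: derivative_eq_intros simp: power2_eq_square)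
    moreover have "((\<lambda>r. K * r) has_real_derivative K) (at r)"
      by (auto intro!: derivative_eq_intros)
    ultimately show "(Q has_real_derivative ?d) (at r)"
      unfolding Q_def by (intro DERIV_diff DERIV_mult dln)
    have "r * D r - mgf W r * ln (mgf W r) \<le> r\<^sup>2 * (a * D r + K * mgf W r)"
      using ent[OF \<open>r > 0\<close> r(2)] unfolding Ent_exp D_def .
    then have "(r * D r - mgf W r * ln (mgf W r) - r\<^sup>2 * (a * D r + K * mgf W r)) / (r\<^sup>2 * mgf W r) \<le> 0"
      using pos[of r] by (intro divide_nonpos_nonneg) auto
    moreover have "?d = (r * D r - mgf W r * ln (mgf W r) - r\<^sup>2 * (a * D r + K * mgf W r)) / (r\<^sup>2 * mgf W r)"
      using \<open>r > 0\<close> pos[of r] by (simp add: field_simps power2_eq_square)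
    ultimately show "?d \<le> 0" by simp
  qed
  have "(Q \<longlongrightarrow> expectation W) (at_right 0)"
  proof -
    have "((\<lambda>h. (ln (mgf W (0 + h)) - ln (mgf W 0)) / h) \<longlongrightarrow> D 0 / mgf W 0) (at 0)"
      using dln[of 0] unfolding DERIV_def .
    then have "((\<lambda>h. ln (mgf W h) / h) \<longlongrightarrow> expectation W) (at_right 0)"
      by (simp add: D_def prob_space filterlim_at_split)
    moreover have "((\<lambda>t. ln (mgf W t)) \<longlongrightarrow> ln (mgf W 0)) (at_right 0)"
      using DERIV_isCont[OF dln[of 0]] by (simp add: isCont_def filterlim_at_split)
    ultimately have "((\<lambda>t. ln (mgf W t) / t - ln (mgf W t) * a - K * t)
        \<longlongrightarrow> expectation W - ln (mgf W 0) * a - K * 0) (at_right 0)"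
      by (intro tendsto_diff tendsto_mult tendsto_const tendsto_ident_at)
    moreover have "Q = (\<lambda>t. ln (mgf W t) / t - ln (mgf W t) * a - K * t)"
      by (simp add: Q_def fun_eq_iff right_diff_distrib)
    ultimately show ?thesis by (simp add: prob_space)
  qed
  moreover have "\<forall>\<^sub>F t in at_right 0. Q L \<le> Q t"
    using decr \<open>L > 0\<close> by (auto intro!: eventually_at_rightI[of 0 L])
  ultimately have "Q L \<le> expectation W"
    by (rule tendsto_lowerbound) simp
  then have "L * Q L \<le> L * expectation W" using \<open>L > 0\<close> by simp
  moreover have "L * Q L = (1 - a * L) * ln (mgf W L) - L * (K * L)"
    using \<open>L > 0\<close> by (simp add: Q_def right_diff_distrib left_diff_distrib)
  ultimately show ?thesis by (simp add: distrib_left)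
qed

text \<open>
  Half of the variational (Gibbs) formula for the entropy, for the density \<open>exp (t W) / mgf W t\<close>.
  It is the integrated form of Young's inequality \<open>x y \<le> x ln x - x + exp y\<close>.
\<close>

lemma expectation_mult_exp_le_Ent:
  assumes W: "W \<in> borel_measurable M" and bound: "\<And>x. x \<in> space M \<Longrightarrow> \<bar>W x\<bar> \<le> N"
    and V: "integrable M V" and eV: "integrable M (\<lambda>x. exp (V x))"
  shows "expectation (\<lambda>x. V x * exp (t * W x))
    \<le> Ent M (\<lambda>x. exp (t * W x)) + mgf W t * ln (expectation (\<lambda>x. exp (V x)))"
proof -
  define \<phi> where "\<phi> = mgf W t"
  define B where "B = expectation (\<lambda>x. exp (V x))"
  have \<phi>: "\<phi> > 0" unfolding \<phi>_def by (rule mgf_pos[OF W bound])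
  have B: "B > 0"
  proof -
    have "B \<noteq> 0"
      using integral_nonneg_eq_0_iff_AE[OF eV] by (auto simp: AE_False B_def)
    moreover have "B \<ge> 0" unfolding B_def by (rule Bochner_Integration.integral_nonneg) simp
    ultimately show ?thesis by linarith
  qed
  have iW: "integrable M W" using W bound by (intro integrable_const_bound[of _ N]) auto
  have ie: "integrable M (\<lambda>x. exp (t * W x))"
    using integrable_mult_exp[OF _ W bound, of "\<lambda>_. 1" t] by simp
  have iV: "integrable M (\<lambda>x. V x * exp (t * W x))" by (rule integrable_mult_exp[OF V W bound])
  have iWe: "integrable M (\<lambda>x. W x * exp (t * W x))" by (rule integrable_mult_exp[OF iW W bound])
  have pt: "V x * exp (t * W x) - ln B * exp (t * W x)
      \<le> t * (W x * exp (t * W x)) - (ln \<phi> + 1) * exp (t * W x) + \<phi> / B * exp (V x)" for x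
  proof -
    \<comment> \<open>Young's inequality for \<open>x = exp (t W) / \<phi>\<close> and \<open>y = V - ln B\<close>, which both make the last two
      terms integrate to 1, is \<open>1 + z \<le> exp z\<close> at \<open>z = y - ln x\<close>.\<close>
    have "1 + (V x - ln B - (t * W x - ln \<phi>)) \<le> exp (V x - ln B - (t * W x - ln \<phi>))"
      by (rule exp_ge_add_one_self)
    also have "\<dots> = exp (V x) / B / (exp (t * W x) / \<phi>)"
      using \<phi> B by (simp add: exp_diff)
    finally have "exp (t * W x) * (1 + (V x - ln B - (t * W x - ln \<phi>)))
        \<le> exp (t * W x) * (exp (V x) / B / (exp (t * W x) / \<phi>))"
      by (rule mult_left_mono) simp
    also have "\<dots> = \<phi> / B * exp (V x)" by simp
    finally show ?thesis by (simp add: algebra_simps)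
  qed
  have "expectation (\<lambda>x. V x * exp (t * W x)) - ln B * \<phi>
      = expectation (\<lambda>x. V x * exp (t * W x) - ln B * exp (t * W x))"
    using ie iV by (simp add: \<phi>_def)
  also have "\<dots> \<le> expectation (\<lambda>x. t * (W x * exp (t * W x)) - (ln \<phi> + 1) * exp (t * W x) + \<phi> / B * exp (V x))"
    using ie iV iWe eV pt by (intro integral_mono) auto
  also have "\<dots> = t * expectation (\<lambda>x. W x * exp (t * W x)) - (ln \<phi> + 1) * \<phi> + \<phi> / B * B"
    using ie iWe eV by (simp add: \<phi>_def B_def)
  also have "\<dots> = Ent M (\<lambda>x. exp (t * W x))"
    using B by (simp add: Ent_exp \<phi>_def algebra_simps)
  finally show ?thesis by (simp add: \<phi>_def B_def algebra_simps)
qed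

lemma expectation_trunc_tendsto:
  assumes "integrable M p"
  shows "(\<lambda>k. expectation (\<lambda>x. trunc (real (Suc k)) (p x))) \<longlonglongrightarrow> expectation p"
proof (rule integral_dominated_convergence[where w = "\<lambda>x. \<bar>p x\<bar>"])
  show "(\<lambda>x. trunc (real (Suc k)) (p x)) \<in> borel_measurable M" for k
    using assms unfolding trunc_def by measurable
  show "AE x in M. norm (trunc (real (Suc k)) (p x)) \<le> \<bar>p x\<bar>" for k
    using abs_trunc_le[of "real (Suc k)"] by simp
qed (use assms trunc_tendsto in auto)

end

section \<open>Consequences of a logarithmic Sobolev inequality\<close>

locale log_sobolev_space = prob_space M for M :: "(real ^ 'n) measure" +
  fixes G :: "(real ^ 'n) set" and s :: real
  assumes open_G: "open G"
    and sets_M: "sets M = sets (restrict_space borel G)"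
    and s_pos: "s > 0"
    and lsi: "log_sobolev G M s"
begin

lemma space_M: "space M = G"
  using sets_eq_imp_space_eq[OF sets_M] by (simp add: space_restrict_space)

lemma measurable_continuous_on:
  fixes u :: "real ^ 'n \<Rightarrow> 'b::topological_space"
  assumes "continuous_on G u"
  shows "u \<in> borel_measurable M"
  using borel_measurable_continuous_on_restrict[OF assms] measurable_cong_sets[OF sets_M refl] by blast

lemma measurable_C1: "C1_on G u \<Longrightarrow> u \<in> borel_measurable M"
  by (intro measurable_continuous_on C1_on_imp_continuous_on)

lemma measurable_norm_gradient:
  "C1_on G u \<Longrightarrow> (\<lambda>x. norm (gradient u x)) \<in> borel_measurable M"
  by (intro measurable_continuous_on continuous_on_norm continuous_on_gradient)

text \<open>
  The logarithmic Sobolev inequality for \<open>u = exp (t W / 2)\<close>, for which \<open>u\<^sup>2 = exp (t W)\<close> and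
  \<open>|\<nabla>u|\<^sup>2 = (t\<^sup>2 / 4) |\<nabla>W|\<^sup>2 exp (t W)\<close>.
\<close>

lemma Ent_exp_le:
  assumes C1: "C1_on G W" and bound: "\<And>x. x \<in> G \<Longrightarrow> \<bar>W x\<bar> \<le> N"
    and int: "integrable M (\<lambda>x. (norm (gradient W x))\<^sup>2)"
  shows "Ent M (\<lambda>x. exp (t * W x))
    \<le> s / 2 * t\<^sup>2 * expectation (\<lambda>x. (norm (gradient W x))\<^sup>2 * exp (t * W x))"
proof -
  have bound': "\<And>x. x \<in> space M \<Longrightarrow> \<bar>W x\<bar> \<le> N" using bound by (simp add: space_M)
  note W = measurable_C1[OF C1]
  define u where "u x = exp (t / 2 * W x)" for x
  have D: "((\<lambda>y. exp (t / 2 * y)) has_real_derivative t / 2 * exp (t / 2 * y)) (at y)" for y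
    by (auto intro!: derivative_eq_intros)
  have "continuous_on UNIV (\<lambda>y. t / 2 * exp (t / 2 * y))" by (intro continuous_intros)
  note chain = C1_on_chain[OF C1 D this, folded u_def]
  have sq: "(u x)\<^sup>2 = exp (t * W x)" for x
    unfolding u_def by (simp add: power2_eq_square exp_add[symmetric])
  have grad: "(grad_norm u x)\<^sup>2 = t\<^sup>2 / 4 * ((norm (gradient W x))\<^sup>2 * exp (t * W x))" if "x \<in> space M" for x
  proof -
    have x: "x \<in> G" using that by (simp add: space_M)
    with chain(1) have "u differentiable (at x)" by (simp add: C1_on_def)
    then have "grad_norm u x = \<bar>t / 2\<bar> * u x * norm (gradient W x)"
      by (simp add: grad_norm_def chain(2)[OF x] u_def[of x] abs_mult)
    then have "(grad_norm u x)\<^sup>2 = (\<bar>t / 2\<bar> * u x * norm (gradient W x))\<^sup>2" by (simp only:)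
    also have "\<dots> = t\<^sup>2 / 4 * ((norm (gradient W x))\<^sup>2 * exp (t * W x))"
      by (simp add: power_mult_distrib sq power_divide)
    finally show ?thesis .
  qed
  have int2: "integrable M (\<lambda>x. (norm (gradient W x))\<^sup>2 * exp (t * W x))"
    by (rule integrable_mult_exp[OF int W bound'])
  have "integrable M (\<lambda>x. (u x)\<^sup>2)"
    using integrable_mult_exp[OF _ W bound', of "\<lambda>_. 1" t] by (simp add: sq)
  moreover have "integrable M (\<lambda>x. (grad_norm u x)\<^sup>2)"
    using int2 by (subst Bochner_Integration.integrable_cong[OF refl grad]) auto
  ultimately have "Ent M (\<lambda>x. (u x)\<^sup>2) \<le> 2 * s * (LINT x|M. (grad_norm u x)\<^sup>2)"
    using lsi C1_on_imp_locally_lipschitz_on[OF open_G chain(1)] unfolding log_sobolev_def by blast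
  also have "(LINT x|M. (grad_norm u x)\<^sup>2)
      = t\<^sup>2 / 4 * expectation (\<lambda>x. (norm (gradient W x))\<^sup>2 * exp (t * W x))"
    by (subst Bochner_Integration.integral_cong[OF refl grad]) auto
  finally show ?thesis by (simp add: sq)
qed

lemma integrable_gradient_trunc:
  assumes "C1_on G p" "integrable M (\<lambda>x. (norm (gradient p x))\<^sup>2)" "k > 0"
  shows "integrable M (\<lambda>x. (norm (gradient (\<lambda>x. trunc k (p x)) x))\<^sup>2)"
proof (rule Bochner_Integration.integrable_bound[OF assms(2)])
  show "(\<lambda>x. (norm (gradient (\<lambda>x. trunc k (p x)) x))\<^sup>2) \<in> borel_measurable M"
    by (intro borel_measurable_power measurable_norm_gradient C1_on_trunc assms)
  show "AE x in M. norm ((norm (gradient (\<lambda>x. trunc k (p x)) x))\<^sup>2) \<le> norm ((norm (gradient p x))\<^sup>2)"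
    using norm_gradient_trunc_le(2)[OF assms(1,3)] by (intro AE_I2) (simp add: space_M)
qed

text \<open>
  The Poincare inequality is the second-order part of the logarithmic Sobolev inequality at
  constants. As \<open>|W| \<le> N\<close>, the Herbst argument on \<open>(0, L]\<close> gives
  \<open>ln (mgf (W - m) L) \<le> K L * L\<^sup>2\<close> with \<open>K L \<rightarrow> s / 2 * D\<close> as \<open>L \<rightarrow> 0\<close>, where \<open>m\<close> is the mean of
  \<open>W\<close> and \<open>D\<close> the integral of \<open>|\<nabla>W|\<^sup>2\<close>. Comparing coefficients of \<open>L\<^sup>2\<close> bounds half the variance by
  \<open>s / 2 * D\<close>.
\<close>

lemma poincare_bounded:
  assumes C1: "C1_on G W" and bound: "\<And>x. x \<in> G \<Longrightarrow> \<bar>W x\<bar> \<le> N"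
    and int: "integrable M (\<lambda>x. (norm (gradient W x))\<^sup>2)"
  shows "expectation (\<lambda>x. (W x - expectation W)\<^sup>2) \<le> s * expectation (\<lambda>x. (norm (gradient W x))\<^sup>2)"
proof -
  have bound': "\<And>x. x \<in> space M \<Longrightarrow> \<bar>W x\<bar> \<le> N" using bound by (simp add: space_M)
  note W = measurable_C1[OF C1]
  define D where "D = expectation (\<lambda>x. (norm (gradient W x))\<^sup>2)"
  have "D \<ge> 0" unfolding D_def by (rule Bochner_Integration.integral_nonneg) simp
  define m where "m = expectation W"
  define Y where "Y x = W x - m" for x
  have Ym: "Y \<in> borel_measurable M" using W by (simp add: Y_def[abs_def])
  have Yb: "\<bar>Y x\<bar> \<le> N + \<bar>m\<bar>" if "x \<in> space M" for x
    using bound'[OF that] by (simp add: Y_def)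
  have iY: "integrable M (\<lambda>x. (Y x) ^ j)" for j
    using Ym power_mono[OF Yb, of _ j]
    by (intro integrable_const_bound[of _ "(N + \<bar>m\<bar>) ^ j"]) (auto simp: power_abs)
  have iW: "integrable M W" using W bound' by (intro integrable_const_bound[of _ N]) auto
  have EY: "expectation Y = 0" using iW by (simp add: Y_def[abs_def] m_def prob_space)
  have ie: "integrable M (\<lambda>x. exp (t * W x))" for t
    using integrable_mult_exp[OF _ W bound', of "\<lambda>_. 1" t] by simp
  \<comment> \<open>One factor \<open>exp (L N)\<close> bounds \<open>exp (t W)\<close> from above, the other one comes from
    \<open>mgf W t \<ge> exp (- L N)\<close>.\<close>
  define K where "K L = s / 2 * D * exp (2 * L * N)" for L
  have main: "expectation (\<lambda>x. (Y x)\<^sup>2) / 2 + L * (expectation (\<lambda>x. (Y x) ^ 3) / 6) \<le> K L * exp (K L * L\<^sup>2)"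
    if "L > 0" for L
  proof -
    have "Ent M (\<lambda>x. exp (t * W x))
        \<le> t\<^sup>2 * (0 * expectation (\<lambda>x. W x * exp (t * W x)) + K L * mgf W t)"
      if t: "0 < t" "t \<le> L" for t
    proof -
      have up: "\<bar>t * W x\<bar> \<le> L * N" if "x \<in> space M" for x
        unfolding abs_mult using t bound'[OF that] by (intro mult_mono) auto
      have "expectation (\<lambda>x. (norm (gradient W x))\<^sup>2 * exp (t * W x))
          \<le> expectation (\<lambda>x. (norm (gradient W x))\<^sup>2 * exp (L * N))"
        using up by (intro integral_mono integrable_mult_exp[OF int W bound'] integrable_mult_left int mult_left_mono)
          (auto dest: abs_le_D1)
      then have 1: "expectation (\<lambda>x. (norm (gradient W x))\<^sup>2 * exp (t * W x)) \<le> D * exp (L * N)"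
        by (simp add: D_def)
      have "exp (- (L * N)) \<le> mgf W t"
        using up by (intro integral_ge_const ie AE_I2) (simp add: abs_le_iff minus_le_iff)
      then have "exp (2 * L * N) * exp (- (L * N)) \<le> exp (2 * L * N) * mgf W t"
        by (rule mult_left_mono) simp
      then have "exp (L * N) \<le> exp (2 * L * N) * mgf W t" by (simp add: exp_add[symmetric])
      from mult_left_mono[OF this \<open>D \<ge> 0\<close>] 1
      have "expectation (\<lambda>x. (norm (gradient W x))\<^sup>2 * exp (t * W x)) \<le> D * (exp (2 * L * N) * mgf W t)"
        by linarith
      then have "s / 2 * t\<^sup>2 * expectation (\<lambda>x. (norm (gradient W x))\<^sup>2 * exp (t * W x))
          \<le> s / 2 * t\<^sup>2 * (D * (exp (2 * L * N) * mgf W t))"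
        using s_pos by (intro mult_left_mono) auto
      with Ent_exp_le[OF C1 bound int, of t] show ?thesis
        by (simp add: K_def mult_ac)
    qed
    from herbst[OF W bound' \<open>L > 0\<close> this]
    have "ln (mgf W L) \<le> L * (m + K L * L)" by (simp add: m_def)
    then have "mgf W L \<le> exp (L * (m + K L * L))"
      using mgf_pos[OF W bound', of L] by (simp add: ln_le_cancel_iff[symmetric] del: ln_le_cancel_iff)
    then have "exp (- (L * m)) * mgf W L \<le> exp (- (L * m)) * exp (L * (m + K L * L))"
      by (rule mult_left_mono) simp
    also have "exp (- (L * m)) * mgf W L = mgf Y L"
    proof -
      have "exp (L * Y x) = exp (- (L * m)) * exp (L * W x)" for x
        by (simp add: Y_def exp_add[symmetric] algebra_simps)
      then show ?thesis by simp
    qed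
    also have "exp (- (L * m)) * exp (L * (m + K L * L)) = exp (K L * L\<^sup>2)"
      by (simp add: exp_add[symmetric] algebra_simps power2_eq_square)
    finally have up: "mgf Y L \<le> exp (K L * L\<^sup>2)" .
    have "1 + L\<^sup>2 / 2 * expectation (\<lambda>x. (Y x)\<^sup>2) + L ^ 3 / 6 * expectation (\<lambda>x. (Y x) ^ 3)
        = expectation (\<lambda>x. 1 + L * Y x + L\<^sup>2 / 2 * (Y x)\<^sup>2 + L ^ 3 / 6 * (Y x) ^ 3)"
      using iY[of 1] iY[of 2] iY[of 3] by (simp add: EY prob_space)
    also have "\<dots> \<le> mgf Y L"
    proof (rule integral_mono)
      show "integrable M (\<lambda>x. exp (L * Y x))"
        using integrable_mult_exp[OF _ Ym Yb, of "\<lambda>_. 1" L] by simp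
      show "1 + L * Y x + L\<^sup>2 / 2 * (Y x)\<^sup>2 + L ^ 3 / 6 * (Y x) ^ 3 \<le> exp (L * Y x)" for x
        using exp_ge_cubic[of "L * Y x"] by (simp add: power_mult_distrib)
    qed (use iY[of 1] iY[of 2] iY[of 3] in auto)
    finally have "L\<^sup>2 / 2 * expectation (\<lambda>x. (Y x)\<^sup>2) + L ^ 3 / 6 * expectation (\<lambda>x. (Y x) ^ 3)
        \<le> K L * L\<^sup>2 * exp (K L * L\<^sup>2)"
      using up exp_minus_one_le[of "K L * L\<^sup>2"] by linarith
    then have "L\<^sup>2 * (expectation (\<lambda>x. (Y x)\<^sup>2) / 2 + L * (expectation (\<lambda>x. (Y x) ^ 3) / 6))
        \<le> L\<^sup>2 * (K L * exp (K L * L\<^sup>2))"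
      by (simp add: power2_eq_square power3_eq_cube algebra_simps)
    then show ?thesis using \<open>L > 0\<close> by simp
  qed
  have "((\<lambda>L. K L * exp (K L * L\<^sup>2)) \<longlongrightarrow> (s / 2 * D * exp (2 * 0 * N)) * exp ((s / 2 * D * exp (2 * 0 * N)) * 0\<^sup>2)) (at_right 0)"
    unfolding K_def by (intro tendsto_intros)
  then have lim1: "((\<lambda>L. K L * exp (K L * L\<^sup>2)) \<longlongrightarrow> s / 2 * D) (at_right 0)" by simp
  have "((\<lambda>L. expectation (\<lambda>x. (Y x)\<^sup>2) / 2 + L * (expectation (\<lambda>x. (Y x) ^ 3) / 6))
      \<longlongrightarrow> expectation (\<lambda>x. (Y x)\<^sup>2) / 2 + 0 * (expectation (\<lambda>x. (Y x) ^ 3) / 6)) (at_right 0)"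
    by (intro tendsto_intros)
  then have lim2: "((\<lambda>L. expectation (\<lambda>x. (Y x)\<^sup>2) / 2 + L * (expectation (\<lambda>x. (Y x) ^ 3) / 6))
      \<longlongrightarrow> expectation (\<lambda>x. (Y x)\<^sup>2) / 2) (at_right 0)" by simp
  have "expectation (\<lambda>x. (Y x)\<^sup>2) / 2 \<le> s / 2 * D"
    by (rule tendsto_le[OF trivial_limit_at_right_real lim1 lim2])
      (use main in \<open>auto intro!: eventually_at_rightI[of 0 1]\<close>)
  then show ?thesis by (simp add: Y_def m_def D_def)
qed

text \<open>
  Square integrability of \<open>p\<close> is part of the conclusion. The means of its truncations tend to the
  mean 0 of \<open>p\<close> because \<open>p\<close> is integrable, so that Fatou's lemma applies to their variances.
\<close>

lemma poincare:
  assumes C1: "C1_on G p" and p: "integrable M p" "expectation p = 0"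
    and int: "integrable M (\<lambda>x. (norm (gradient p x))\<^sup>2)"
  shows "(\<integral>\<^sup>+ x. ennreal ((p x)\<^sup>2) \<partial>M) \<le> ennreal (s * expectation (\<lambda>x. (norm (gradient p x))\<^sup>2))"
proof (rule nn_integral_le_tendsto)
  define W where "W k x = trunc (real (Suc k)) (p x)" for k x
  have C1W: "C1_on G (W k)" for k unfolding W_def by (rule C1_on_trunc[OF C1]) simp
  have bW: "\<bar>W k x\<bar> \<le> 2 * real (Suc k)" for k x
    unfolding W_def by (rule abs_trunc_bounded) simp
  have intW: "integrable M (\<lambda>x. (norm (gradient (W k) x))\<^sup>2)" for k
    unfolding W_def[abs_def] by (rule integrable_gradient_trunc[OF C1 int]) simp
  note [measurable] = measurable_C1[OF C1W]
  show "(\<lambda>x. ennreal ((W k x - expectation (W k))\<^sup>2)) \<in> borel_measurable M" for k by measurable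
  have lim: "(\<lambda>k. expectation (W k)) \<longlonglongrightarrow> 0"
    using expectation_trunc_tendsto[OF p(1)] by (simp add: W_def[abs_def] p(2))
  show "(\<lambda>k. ennreal ((W k x - expectation (W k))\<^sup>2)) \<longlonglongrightarrow> ennreal ((p x)\<^sup>2)" for x
    using tendsto_power[OF tendsto_diff[OF trunc_tendsto[of "p x"] lim], of 2]
    by (simp add: W_def[abs_def])
  show "(\<integral>\<^sup>+ x. ennreal ((W k x - expectation (W k))\<^sup>2) \<partial>M)
      \<le> ennreal (s * expectation (\<lambda>x. (norm (gradient p x))\<^sup>2))" for k
  proof -
    have "integrable M (\<lambda>x. (W k x - expectation (W k))\<^sup>2)"
    proof (rule integrable_const_bound)
      have "\<bar>W k x - expectation (W k)\<bar> \<le> 2 * real (Suc k) + \<bar>expectation (W k)\<bar>" for x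
        using bW[of k x] by linarith
      from power_mono[OF this abs_ge_zero, where n = 2]
      have "norm ((W k x - expectation (W k))\<^sup>2) \<le> (2 * real (Suc k) + \<bar>expectation (W k)\<bar>)\<^sup>2" for x
        by (simp only: real_norm_def power2_abs abs_power2)
      then show "AE x in M. norm ((W k x - expectation (W k))\<^sup>2) \<le> (2 * real (Suc k) + \<bar>expectation (W k)\<bar>)\<^sup>2"
        by (rule AE_I2)
    qed measurable
    then have "(\<integral>\<^sup>+ x. ennreal ((W k x - expectation (W k))\<^sup>2) \<partial>M)
        = ennreal (expectation (\<lambda>x. (W k x - expectation (W k))\<^sup>2))"
      by (intro nn_integral_eq_integral) auto
    also have "\<dots> \<le> ennreal (s * expectation (\<lambda>x. (norm (gradient p x))\<^sup>2))"
    proof (rule ennreal_leI)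
      have "expectation (\<lambda>x. (norm (gradient (W k) x))\<^sup>2) \<le> expectation (\<lambda>x. (norm (gradient p x))\<^sup>2)"
        using norm_gradient_trunc_le(2)[OF C1, of "real (Suc k)"]
        by (intro integral_mono intW int) (simp add: W_def[abs_def] space_M)
      from mult_left_mono[OF this, of s] poincare_bounded[OF C1W bW intW, of k]
      show "expectation (\<lambda>x. (W k x - expectation (W k))\<^sup>2)
          \<le> s * expectation (\<lambda>x. (norm (gradient p x))\<^sup>2)"
        using s_pos by linarith
    qed
    finally show ?thesis .
  qed
qed (rule tendsto_const)

text \<open>
  If \<open>|\<nabla>W|\<^sup>2 \<le> 4 W\<close>, then \<open>Ent_exp_le\<close> bounds the entropy of \<open>exp (t W)\<close> by \<open>2 s t\<^sup>2\<close> times the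
  derivative of the moment generating function, so the Herbst argument applies with \<open>a = 2 s\<close> and
  \<open>K = 0\<close>.
\<close>

lemma exp_self_bounding:
  assumes C1: "C1_on G h" and nonneg: "\<And>x. x \<in> G \<Longrightarrow> 0 \<le> h x"
    and grad: "\<And>x. x \<in> G \<Longrightarrow> (norm (gradient h x))\<^sup>2 \<le> 4 * h x"
    and int: "integrable M h" and L: "0 < L" "2 * s * L < 1"
  shows "(\<integral>\<^sup>+ x. ennreal (exp (L * h x)) \<partial>M) \<le> ennreal (exp (L * expectation h / (1 - 2 * s * L)))"
proof (rule nn_integral_le_tendsto)
  define W where "W k x = trunc (real (Suc k)) (h x)" for k x
  have C1W: "C1_on G (W k)" for k unfolding W_def by (rule C1_on_trunc[OF C1]) simp
  have bW: "\<bar>W k x\<bar> \<le> 2 * real (Suc k)" for k x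
    unfolding W_def by (rule abs_trunc_bounded) simp
  note mW [measurable] = measurable_C1[OF C1W]
  have iW: "integrable M (W k)" for k
    by (rule integrable_const_bound[of _ "2 * real (Suc k)"]) (use bW in auto)
  have gradW: "(norm (gradient (W k) x))\<^sup>2 \<le> 4 * W k x" if "x \<in> G" for k x
  proof -
    have "(norm (gradient (W k) x))\<^sup>2 \<le> 1 / (1 + (h x / real (Suc k))\<^sup>2) * (norm (gradient h x))\<^sup>2"
      unfolding W_def[abs_def] by (rule norm_gradient_trunc_le(1)[OF C1 _ that]) simp
    also have "\<dots> \<le> 1 / (1 + (h x / real (Suc k))\<^sup>2) * (4 * h x)"
      by (rule mult_left_mono[OF grad[OF that]]) simp
    also have "\<dots> = 4 * (h x / (1 + (h x / real (Suc k))\<^sup>2))" by simp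
    also have "\<dots> \<le> 4 * W k x"
      unfolding W_def using nonneg[OF that] by (intro mult_left_mono trunc_ge) auto
    finally show ?thesis .
  qed
  have intW: "integrable M (\<lambda>x. (norm (gradient (W k) x))\<^sup>2)" for k
  proof (rule Bochner_Integration.integrable_bound)
    show "integrable M (\<lambda>x. 4 * W k x)" using iW by simp
    show "(\<lambda>x. (norm (gradient (W k) x))\<^sup>2) \<in> borel_measurable M"
      by (intro borel_measurable_power measurable_norm_gradient C1W)
    show "AE x in M. norm ((norm (gradient (W k) x))\<^sup>2) \<le> norm (4 * W k x)"
      using order_trans[OF gradW abs_ge_self] by (intro AE_I2) (simp add: space_M)
  qed
  show "(\<lambda>x. ennreal (exp (L * W k x))) \<in> borel_measurable M" for k by measurable
  show "(\<lambda>k. ennreal (exp (L * W k x))) \<longlonglongrightarrow> ennreal (exp (L * h x))" for x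
    unfolding W_def by (intro tendsto_ennrealI tendsto_exp tendsto_mult tendsto_const trunc_tendsto)
  show "(\<integral>\<^sup>+ x. ennreal (exp (L * W k x)) \<partial>M)
      \<le> ennreal (exp (L * expectation h / (1 - 2 * s * L)))" for k
  proof -
    have "Ent M (\<lambda>x. exp (t * W k x))
        \<le> t\<^sup>2 * (2 * s * expectation (\<lambda>x. W k x * exp (t * W k x)) + 0 * mgf (W k) t)" for t
    proof -
      have "expectation (\<lambda>x. (norm (gradient (W k) x))\<^sup>2 * exp (t * W k x))
          \<le> expectation (\<lambda>x. 4 * (W k x * exp (t * W k x)))"
      proof (rule integral_mono)
        show "integrable M (\<lambda>x. (norm (gradient (W k) x))\<^sup>2 * exp (t * W k x))"
          by (rule integrable_mult_exp[OF intW mW bW])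
        show "integrable M (\<lambda>x. 4 * (W k x * exp (t * W k x)))"
          by (intro integrable_mult_right integrable_mult_exp[OF iW mW bW])
        show "(norm (gradient (W k) x))\<^sup>2 * exp (t * W k x) \<le> 4 * (W k x * exp (t * W k x))"
          if "x \<in> space M" for x
          using mult_right_mono[OF gradW, of x "exp (t * W k x)" k] that by (simp add: space_M mult_ac)
      qed
      also have "\<dots> = 4 * expectation (\<lambda>x. W k x * exp (t * W k x))"
        by (rule integral_mult_right_zero)
      finally have "s / 2 * t\<^sup>2 * expectation (\<lambda>x. (norm (gradient (W k) x))\<^sup>2 * exp (t * W k x))
          \<le> s / 2 * t\<^sup>2 * (4 * expectation (\<lambda>x. W k x * exp (t * W k x)))"
        using s_pos by (intro mult_left_mono) auto
      with Ent_exp_le[OF C1W bW intW, of t k] show ?thesis by (simp add: mult_ac)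
    qed
    from herbst[OF mW bW L(1) this]
    have "(1 - 2 * s * L) * ln (mgf (W k) L) \<le> L * expectation (W k)" by simp
    also have "\<dots> \<le> L * expectation h"
    proof (intro mult_left_mono integral_mono iW int)
      show "W k x \<le> h x" if "x \<in> space M" for x
      proof -
        have "\<bar>W k x\<bar> \<le> \<bar>h x\<bar>" unfolding W_def by (rule abs_trunc_le) simp
        moreover have "0 \<le> h x" using nonneg that by (simp add: space_M)
        ultimately show ?thesis by linarith
      qed
    qed (use L in simp)
    finally have "ln (mgf (W k) L) \<le> L * expectation h / (1 - 2 * s * L)"
      using L by (simp add: pos_le_divide_eq mult.commute)
    then have "mgf (W k) L \<le> exp (L * expectation h / (1 - 2 * s * L))"
      using mgf_pos[OF mW bW, of L k] by (simp add: ln_le_cancel_iff[symmetric] del: ln_le_cancel_iff)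
    moreover have "(\<integral>\<^sup>+ x. ennreal (exp (L * W k x)) \<partial>M) = ennreal (mgf (W k) L)"
      using integrable_mult_exp[where V = "\<lambda>_. 1" and t = L, OF _ mW bW] by (intro nn_integral_eq_integral) auto
    ultimately show ?thesis by (simp add: ennreal_leI)
  qed
qed (rule tendsto_const)

text \<open>
  Exponential moments of \<open>f\<close> are controlled by exponential moments of a bound \<open>h\<close> on the squared
  gradient: two copies of the entropy of \<open>exp (t W)\<close> are bounded by one copy plus a term of the form
  \<open>K t\<^sup>2 mgf W t\<close>. Having \<open>h\<close> as a parameter lets the same hypotheses serve \<open>f\<close> and \<open>-f\<close>.
\<close>

lemma exp_le_exp_sq_gradient:
  assumes C1: "C1_on G f" and f: "integrable M f" "expectation f = 0"
    and h: "integrable M h" and grad: "\<And>x. x \<in> G \<Longrightarrow> (norm (gradient f x))\<^sup>2 \<le> h x"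
    and L: "0 < L"
    and eint: "\<And>t. 0 < t \<Longrightarrow> t \<le> L \<Longrightarrow> integrable M (\<lambda>x. exp (s * t\<^sup>2 * h x))"
    and ebound: "\<And>t. 0 < t \<Longrightarrow> t \<le> L \<Longrightarrow>
      ln (expectation (\<lambda>x. exp (s * t\<^sup>2 * h x))) \<le> t\<^sup>2 * K"
  shows "(\<integral>\<^sup>+ x. ennreal (exp (L * f x)) \<partial>M) \<le> ennreal (exp (L\<^sup>2 * K))"
proof (rule nn_integral_le_tendsto)
  define W where "W k x = trunc (real (Suc k)) (f x)" for k x
  have C1W: "C1_on G (W k)" for k unfolding W_def by (rule C1_on_trunc[OF C1]) simp
  have bW: "\<bar>W k x\<bar> \<le> 2 * real (Suc k)" for k x
    unfolding W_def by (rule abs_trunc_bounded) simp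
  note mW [measurable] = measurable_C1[OF C1W]
  have int: "integrable M (\<lambda>x. (norm (gradient f x))\<^sup>2)"
  proof (rule Bochner_Integration.integrable_bound[OF h])
    show "(\<lambda>x. (norm (gradient f x))\<^sup>2) \<in> borel_measurable M"
      by (intro borel_measurable_power measurable_norm_gradient C1)
    show "AE x in M. norm ((norm (gradient f x))\<^sup>2) \<le> norm (h x)"
      using order_trans[OF grad abs_ge_self] by (intro AE_I2) (simp add: space_M)
  qed
  have intW: "integrable M (\<lambda>x. (norm (gradient (W k) x))\<^sup>2)" for k
    unfolding W_def[abs_def] by (rule integrable_gradient_trunc[OF C1 int]) simp
  show "(\<lambda>x. ennreal (exp (L * W k x))) \<in> borel_measurable M" for k by measurable
  show "(\<lambda>k. ennreal (exp (L * W k x))) \<longlonglongrightarrow> ennreal (exp (L * f x))" for x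
    unfolding W_def by (intro tendsto_ennrealI tendsto_exp tendsto_mult tendsto_const trunc_tendsto)
  have lim: "(\<lambda>k. expectation (W k)) \<longlonglongrightarrow> 0"
    using expectation_trunc_tendsto[OF f(1)] by (simp add: W_def[abs_def] f(2))
  have "(\<lambda>k. ennreal (exp (L * (expectation (W k) + K * L)))) \<longlonglongrightarrow> ennreal (exp (L * (0 + K * L)))"
    by (intro tendsto_ennrealI tendsto_exp tendsto_mult tendsto_add tendsto_const lim)
  then show "(\<lambda>k. ennreal (exp (L * (expectation (W k) + K * L)))) \<longlonglongrightarrow> ennreal (exp (L\<^sup>2 * K))"
    by (simp add: power2_eq_square mult_ac)
  show "(\<integral>\<^sup>+ x. ennreal (exp (L * W k x)) \<partial>M) \<le> ennreal (exp (L * (expectation (W k) + K * L)))" for k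
  proof -
    have "Ent M (\<lambda>x. exp (t * W k x))
        \<le> t\<^sup>2 * (0 * expectation (\<lambda>x. W k x * exp (t * W k x)) + K * mgf (W k) t)"
      if t: "0 < t" "t \<le> L" for t
    proof -
      define V where "V x = s * t\<^sup>2 * h x" for x
      have V: "integrable M V" using h by (simp add: V_def[abs_def])
      have "2 * Ent M (\<lambda>x. exp (t * W k x))
          \<le> expectation (\<lambda>x. s * t\<^sup>2 * ((norm (gradient (W k) x))\<^sup>2 * exp (t * W k x)))"
        using Ent_exp_le[OF C1W bW intW, of t k] by simp
      also have "\<dots> \<le> expectation (\<lambda>x. V x * exp (t * W k x))"
      proof (rule integral_mono)
        show "integrable M (\<lambda>x. s * t\<^sup>2 * ((norm (gradient (W k) x))\<^sup>2 * exp (t * W k x)))"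
          by (intro integrable_mult_right integrable_mult_exp[OF intW mW bW])
        show "integrable M (\<lambda>x. V x * exp (t * W k x))" by (rule integrable_mult_exp[OF V mW bW])
        show "s * t\<^sup>2 * ((norm (gradient (W k) x))\<^sup>2 * exp (t * W k x)) \<le> V x * exp (t * W k x)"
          if "x \<in> space M" for x
        proof -
          have "x \<in> G" using that by (simp add: space_M)
          have "(norm (gradient (W k) x))\<^sup>2 \<le> (norm (gradient f x))\<^sup>2"
            unfolding W_def[abs_def] by (rule norm_gradient_trunc_le(2)[OF C1 _ \<open>x \<in> G\<close>]) simp
          also have "\<dots> \<le> h x" by (rule grad[OF \<open>x \<in> G\<close>])
          finally have "(norm (gradient (W k) x))\<^sup>2 \<le> h x" .
          then have "s * t\<^sup>2 * ((norm (gradient (W k) x))\<^sup>2 * exp (t * W k x))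
              \<le> s * t\<^sup>2 * (h x * exp (t * W k x))"
            using s_pos by (intro mult_left_mono mult_right_mono) auto
          then show ?thesis by (simp add: V_def mult_ac)
        qed
      qed
      also have "\<dots> \<le> Ent M (\<lambda>x. exp (t * W k x)) + mgf (W k) t * ln (expectation (\<lambda>x. exp (V x)))"
        by (rule expectation_mult_exp_le_Ent[OF mW bW V]) (use eint[OF t] in \<open>simp add: V_def\<close>)
      also have "mgf (W k) t * ln (expectation (\<lambda>x. exp (V x))) \<le> mgf (W k) t * (t\<^sup>2 * K)"
        unfolding V_def using mgf_pos[OF mW bW, of t k] by (intro mult_left_mono ebound[OF t]) auto
      finally show ?thesis by (simp add: mult_ac)
    qed
    from herbst[OF mW bW L this]
    have "ln (mgf (W k) L) \<le> L * (expectation (W k) + K * L)" by simp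
    then have "mgf (W k) L \<le> exp (L * (expectation (W k) + K * L))"
      using mgf_pos[OF mW bW, of L k] by (simp add: ln_le_cancel_iff[symmetric] del: ln_le_cancel_iff)
    moreover have "(\<integral>\<^sup>+ x. ennreal (exp (L * W k x)) \<partial>M) = ennreal (mgf (W k) L)"
      using integrable_mult_exp[where V = "\<lambda>_. 1" and t = L, OF _ mW bW] by (intro nn_integral_eq_integral) auto
    ultimately show ?thesis by (simp add: ennreal_leI)
  qed
qed


text \<open>
  The operator norm bound makes \<open>h = |\<nabla>f|\<^sup>2\<close> self-bounding, so \<open>exp_self_bounding\<close> at the exponent
  \<open>s t\<^sup>2\<close> supplies the exponential moments required by \<open>exp_le_exp_sq_gradient\<close>. The denominator is
  smallest at \<open>t = L\<close>, which gives a constant \<open>K\<close> valid for all \<open>t \<le> L\<close>.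
\<close>

lemma exp_le_expectation_sq_gradient:
  assumes C2: "C2_on G f" and f: "integrable M f" "expectation f = 0"
    and op: "\<And>x. x \<in> G \<Longrightarrow> op_norm (hessian f x) \<le> 1"
    and int: "integrable M (\<lambda>x. (norm (gradient f x))\<^sup>2)"
    and L: "0 < L" "2 * (s * L)\<^sup>2 < 1"
  defines "K \<equiv> s * expectation (\<lambda>x. (norm (gradient f x))\<^sup>2) / (1 - 2 * (s * L)\<^sup>2)"
  shows "(\<integral>\<^sup>+ x. ennreal (exp (L * f x)) \<partial>M) \<le> ennreal (exp (L\<^sup>2 * K))"
    and "(\<integral>\<^sup>+ x. ennreal (exp (L * - f x)) \<partial>M) \<le> ennreal (exp (L\<^sup>2 * K))"
proof -
  define h where "h x = (norm (gradient f x))\<^sup>2" for x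
  have C1: "C1_on G f" using C2 by (simp add: C2_on_def)
  have C1h: "C1_on G h" unfolding h_def by (rule gradient_sq_norm_gradient(1)[OF C2])
  have inth: "integrable M h" using int by (simp add: h_def[abs_def])
  have Eh: "0 \<le> expectation h" unfolding h_def by (rule Bochner_Integration.integral_nonneg) simp
  have gradh: "(norm (gradient h x))\<^sup>2 \<le> 4 * h x" if x: "x \<in> G" for x
  proof -
    have "norm (hessian f x *v gradient f x) \<le> op_norm (hessian f x) * norm (gradient f x)"
      unfolding op_norm_def by (rule onorm[OF matrix_vector_mul_bounded_linear])
    also have "\<dots> \<le> 1 * norm (gradient f x)" by (intro mult_right_mono op x) simp
    finally have "(norm (hessian f x *v gradient f x))\<^sup>2 \<le> h x"
      unfolding h_def by (intro power_mono) auto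
    then show ?thesis
      unfolding h_def[abs_def] gradient_sq_norm_gradient(2)[OF C2 x] by (simp add: power_mult_distrib)
  qed
  have *: "integrable M (\<lambda>x. exp (s * t\<^sup>2 * h x)) \<and> ln (expectation (\<lambda>x. exp (s * t\<^sup>2 * h x))) \<le> t\<^sup>2 * K"
    if t: "0 < t" "t \<le> L" for t
  proof -
    have "(s * t)\<^sup>2 \<le> (s * L)\<^sup>2" using t s_pos by (intro power_mono mult_left_mono) auto
    then have le: "2 * s * (s * t\<^sup>2) \<le> 2 * (s * L)\<^sup>2" by (simp add: power2_eq_square mult_ac)
    have "(\<integral>\<^sup>+ x. ennreal (exp (s * t\<^sup>2 * h x)) \<partial>M)
        \<le> ennreal (exp (s * t\<^sup>2 * expectation h / (1 - 2 * s * (s * t\<^sup>2))))"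
      using t s_pos le L by (intro exp_self_bounding[OF C1h _ gradh inth]) (auto simp: h_def)
    note nn = nn_integral_le_imp_integral_le[OF _ _ _ this]
    have m: "(\<lambda>x. exp (s * t\<^sup>2 * h x)) \<in> borel_measurable M"
      using measurable_C1[OF C1h] by measurable
    have int': "integrable M (\<lambda>x. exp (s * t\<^sup>2 * h x))" by (rule nn(1)[OF m]) auto
    have E: "expectation (\<lambda>x. exp (s * t\<^sup>2 * h x))
        \<le> exp (s * t\<^sup>2 * expectation h / (1 - 2 * s * (s * t\<^sup>2)))" by (rule nn(2)[OF m]) auto
    have "1 \<le> expectation (\<lambda>x. exp (s * t\<^sup>2 * h x))"
      using s_pos by (intro integral_ge_const int' AE_I2) (auto simp: h_def)
    with E have "ln (expectation (\<lambda>x. exp (s * t\<^sup>2 * h x)))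
        \<le> ln (exp (s * t\<^sup>2 * expectation h / (1 - 2 * s * (s * t\<^sup>2))))"
      by (subst ln_le_cancel_iff) auto
    also have "\<dots> = s * t\<^sup>2 * expectation h / (1 - 2 * s * (s * t\<^sup>2))" by (rule ln_exp)
    also have "\<dots> \<le> s * t\<^sup>2 * expectation h / (1 - 2 * (s * L)\<^sup>2)"
      using le L Eh s_pos by (intro divide_left_mono mult_nonneg_nonneg mult_pos_pos) auto
    also have "\<dots> = t\<^sup>2 * K" by (simp add: K_def h_def[abs_def])
    finally show ?thesis using int' by simp
  qed
  show "(\<integral>\<^sup>+ x. ennreal (exp (L * f x)) \<partial>M) \<le> ennreal (exp (L\<^sup>2 * K))"
    by (rule exp_le_exp_sq_gradient[OF C1 f inth _ L(1)]) (use * in \<open>auto simp: h_def\<close>)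
  note neg = C1_on_chain[OF C1, of uminus "\<lambda>_. - 1"]
  have C1': "C1_on G (\<lambda>x. - f x)" by (rule neg(1)) (auto intro!: derivative_eq_intros)
  have grad': "gradient (\<lambda>x. - f x) x = - 1 *\<^sub>R gradient f x" if "x \<in> G" for x
    by (rule neg(2)) (use that in \<open>auto intro!: derivative_eq_intros\<close>)
  show "(\<integral>\<^sup>+ x. ennreal (exp (L * - f x)) \<partial>M) \<le> ennreal (exp (L\<^sup>2 * K))"
    by (rule exp_le_exp_sq_gradient[OF C1' _ _ inth _ L(1)]) (use * f grad' in \<open>auto simp: h_def\<close>)
qed

text \<open>
  The Poincare inequality for each partial derivative: the squared gradients of the \<open>\<partial>\<^sub>i f\<close> sum up to
  the squared Hilbert-Schmidt norm of the Hessian.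
\<close>

lemma expectation_sq_gradient_le:
  assumes C2: "C2_on G f"
    and p: "\<And>i. integrable M (partial_deriv i f)" "\<And>i. expectation (partial_deriv i f) = 0"
    and hs: "(\<integral>\<^sup>+ x. ennreal ((hs_norm (hessian f x))\<^sup>2) \<partial>M) \<le> ennreal B" and "0 \<le> B"
  shows "integrable M (\<lambda>x. (norm (gradient f x))\<^sup>2)"
    and "expectation (\<lambda>x. (norm (gradient f x))\<^sup>2) \<le> s * B"
proof -
  have C1: "C1_on G f" "C1_on G (partial_deriv i f)" for i using C2 by (auto simp: C2_on_def)
  define q where "q i x = (norm (gradient (partial_deriv i f) x))\<^sup>2" for i x
  have qm [measurable]: "q i \<in> borel_measurable M" for i
    unfolding q_def[abs_def] by (intro borel_measurable_power measurable_norm_gradient C1)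
  have sq: "(norm v)\<^sup>2 = (\<Sum>i\<in>UNIV. (v $ i)\<^sup>2)" for v :: "real ^ 'n"
    by (simp add: norm_vec_def L2_set_def sum_nonneg)
  have hs_eq: "(hs_norm (hessian f x))\<^sup>2 = (\<Sum>i\<in>UNIV. q i x)" for x
  proof -
    have "(hs_norm (hessian f x))\<^sup>2 = (\<Sum>j\<in>UNIV. \<Sum>i\<in>UNIV. (partial_deriv j (partial_deriv i f) x)\<^sup>2)"
      by (simp add: hs_norm_def hessian_def sum_nonneg)
    also have "\<dots> = (\<Sum>i\<in>UNIV. q i x)"
      by (subst sum.swap) (simp add: q_def sq gradient_def)
    finally show ?thesis .
  qed
  have "(\<lambda>x. \<Sum>i\<in>UNIV. q i x) \<in> borel_measurable M" by measurable
  note nn = nn_integral_le_imp_integral_le[OF this _ \<open>0 \<le> B\<close> hs[unfolded hs_eq]]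
  have q0: "0 \<le> q i x" for i x by (simp add: q_def)
  have intq: "integrable M (\<lambda>x. \<Sum>i\<in>UNIV. q i x)" and Eq: "expectation (\<lambda>x. \<Sum>i\<in>UNIV. q i x) \<le> B"
    by (intro nn sum_nonneg q0)+
  have iq: "integrable M (q i)" for i
  proof (rule Bochner_Integration.integrable_bound[OF intq qm], rule AE_I2)
    show "norm (q i x) \<le> norm (\<Sum>i\<in>UNIV. q i x)" for x
      using member_le_sum[of i UNIV "\<lambda>i. q i x"] q0 by (simp add: sum_nonneg)
  qed
  have "(\<integral>\<^sup>+ x. ennreal ((norm (gradient f x))\<^sup>2) \<partial>M)
      = (\<integral>\<^sup>+ x. (\<Sum>i\<in>UNIV. ennreal ((partial_deriv i f x)\<^sup>2)) \<partial>M)"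
    by (simp add: sq gradient_def)
  also have "\<dots> = (\<Sum>i\<in>UNIV. \<integral>\<^sup>+ x. ennreal ((partial_deriv i f x)\<^sup>2) \<partial>M)"
    using measurable_C1[OF C1(2)] by (intro nn_integral_sum) measurable
  also have "\<dots> \<le> (\<Sum>i\<in>UNIV. ennreal (s * expectation (q i)))"
    unfolding q_def[abs_def]
    by (intro sum_mono poincare[OF C1(2) p]) (use iq in \<open>simp add: q_def[abs_def]\<close>)
  also have "\<dots> = ennreal (s * expectation (\<lambda>x. \<Sum>i\<in>UNIV. q i x))"
    using s_pos q0 iq by (simp add: sum_distrib_left)
  also have "\<dots> \<le> ennreal (s * B)"
    using s_pos Eq by (intro ennreal_leI mult_left_mono) auto
  finally have le: "(\<integral>\<^sup>+ x. ennreal ((norm (gradient f x))\<^sup>2) \<partial>M) \<le> ennreal (s * B)" .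
  have "(\<lambda>x. (norm (gradient f x))\<^sup>2) \<in> borel_measurable M"
    by (intro borel_measurable_power measurable_norm_gradient C1)
  from nn_integral_le_imp_integral_le[OF this _ _ le] s_pos \<open>0 \<le> B\<close>
  show "integrable M (\<lambda>x. (norm (gradient f x))\<^sup>2)"
    and "expectation (\<lambda>x. (norm (gradient f x))\<^sup>2) \<le> s * B" by simp_all
qed

end

section \<open>Second order concentration\<close>

text \<open>
  With \<open>a = exp (4/3 c |f|)\<close> the hypotheses give \<open>\<integral> a \<le> 2 exp (ln 2 / 3) = 2\<^bsup>4/3\<^esup>\<close>, and
  \<open>\<integral> a\<^bsup>3/4\<^esup> \<le> 2\<close> follows as in Jensen's inequality, here from the tangent line of
  \<open>a\<^bsup>3/4\<^esup>\<close> at \<open>a = 2\<^bsup>4/3\<^esup>\<close>.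
\<close>

lemma nn_integral_exp_abs_le_2:
  assumes "prob_space M" and f: "f \<in> borel_measurable M"
    and pos: "(\<integral>\<^sup>+ x. ennreal (exp (4 / 3 * c * f x)) \<partial>M) \<le> ennreal (exp (ln 2 / 3))"
    and neg: "(\<integral>\<^sup>+ x. ennreal (exp (4 / 3 * c * - f x)) \<partial>M) \<le> ennreal (exp (ln 2 / 3))"
  shows "(\<integral>\<^sup>+ x. ennreal (exp (c * \<bar>f x\<bar>)) \<partial>M) \<le> 2"
proof -
  interpret prob_space M by fact
  define A :: real where "A = 3 / 2 * exp (- (4 / 3 * ln 2))"
  have "A \<ge> 0" by (simp add: A_def)
  have pt: "exp (c * \<bar>f x\<bar>) \<le> 1 / 2 + A * (exp (4 / 3 * c * f x) + exp (4 / 3 * c * - f x))" for x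
  proof -
    define y where "y = 4 / 3 * c * \<bar>f x\<bar>"
    have "exp (c * \<bar>f x\<bar>) = exp (ln 2 + 3 / 4 * (y - 4 / 3 * ln 2))"
      by (simp add: y_def algebra_simps)
    also have "\<dots> = 2 * exp (3 / 4 * (y - 4 / 3 * ln 2))" by (simp add: exp_add)
    also have "\<dots> \<le> 2 * (1 / 4 + 3 / 4 * exp (y - 4 / 3 * ln 2))"
      by (intro mult_left_mono exp_three_quarters_le) simp
    also have "exp (y - 4 / 3 * ln 2) = exp (- (4 / 3 * ln 2)) * exp y"
      by (simp add: exp_add[symmetric])
    also have "2 * (1 / 4 + 3 / 4 * (exp (- (4 / 3 * ln 2)) * exp y)) = 1 / 2 + A * exp y"
      by (simp add: A_def)
    also have "\<dots> \<le> 1 / 2 + A * (exp (4 / 3 * c * f x) + exp (4 / 3 * c * - f x))"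
      using \<open>A \<ge> 0\<close> by (intro add_left_mono mult_left_mono) (auto simp: y_def abs_if)
    finally show ?thesis .
  qed
  have "(\<integral>\<^sup>+ x. ennreal (exp (c * \<bar>f x\<bar>)) \<partial>M)
      \<le> (\<integral>\<^sup>+ x. ennreal (1 / 2) + ennreal A * (ennreal (exp (4 / 3 * c * f x)) + ennreal (exp (4 / 3 * c * - f x))) \<partial>M)"
  proof (rule nn_integral_mono)
    fix x
    have "ennreal (exp (c * \<bar>f x\<bar>)) \<le> ennreal (1 / 2 + A * (exp (4 / 3 * c * f x) + exp (4 / 3 * c * - f x)))"
      by (rule ennreal_leI[OF pt])
    also have "\<dots> = ennreal (1 / 2) + ennreal A * (ennreal (exp (4 / 3 * c * f x)) + ennreal (exp (4 / 3 * c * - f x)))"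
      using \<open>A \<ge> 0\<close> by (simp only: ennreal_plus ennreal_mult exp_ge_zero add_nonneg_nonneg mult_nonneg_nonneg zero_le_divide_1_iff zero_le_numeral)
    finally show "ennreal (exp (c * \<bar>f x\<bar>)) \<le> ennreal (1 / 2) + ennreal A * (ennreal (exp (4 / 3 * c * f x)) + ennreal (exp (4 / 3 * c * - f x)))" .
  qed
  also have "\<dots> = ennreal (1 / 2) + ennreal A * ((\<integral>\<^sup>+ x. ennreal (exp (4 / 3 * c * f x)) \<partial>M)
      + (\<integral>\<^sup>+ x. ennreal (exp (4 / 3 * c * - f x)) \<partial>M))"
    using f by (simp add: nn_integral_add nn_integral_cmult emeasure_space_1)
  also have "\<dots> \<le> ennreal (1 / 2) + ennreal A * (ennreal (exp (ln 2 / 3)) + ennreal (exp (ln 2 / 3)))"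
    by (intro add_mono mult_left_mono pos neg) auto
  also have "\<dots> = ennreal (1 / 2 + A * (exp (ln 2 / 3) + exp (ln 2 / 3)))"
    using \<open>A \<ge> 0\<close> by (simp only: ennreal_plus ennreal_mult exp_ge_zero add_nonneg_nonneg mult_nonneg_nonneg zero_le_divide_1_iff zero_le_numeral)
  also have "1 / 2 + A * (exp (ln 2 / 3) + exp (ln 2 / 3)) = 2"
  proof -
    have "exp (- (4 / 3 * ln 2)) * exp (ln 2 / 3) = exp (- ln (2::real))"
      by (simp add: exp_add[symmetric])
    also have "\<dots> = 1 / 2" by (simp add: exp_minus)
    finally show ?thesis by (simp add: A_def algebra_simps)
  qed
  finally show ?thesis by simp
qed

theorem theorem1p4:
  fixes G :: "(real ^ 'n) set" and \<mu> :: "(real ^ 'n) measure"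
    and f :: "real ^ 'n \<Rightarrow> real" and \<sigma> b :: real
  assumes "open G"
    and "prob_space \<mu>"
    and "sets \<mu> = sets (restrict_space borel G)"
    and "\<sigma>\<^sup>2 > 0"
    and "log_sobolev G \<mu> (\<sigma>\<^sup>2)"
    and "C2_on G f"
    and "integrable \<mu> f"
    and "\<And>i. integrable \<mu> (partial_deriv i f)"
    and "(LINT x|\<mu>. f x) = 0"
    and "\<And>i. (LINT x|\<mu>. partial_deriv i f x) = 0"
    and "b \<ge> 0"
    and "\<And>x. x \<in> G \<Longrightarrow> op_norm (hessian f x) \<le> 1"
    and "(\<integral>\<^sup>+ x. ennreal ((hs_norm (hessian f x))\<^sup>2) \<partial>\<mu>) \<le> ennreal (b\<^sup>2)"
  shows "(\<integral>\<^sup>+ x. ennreal (exp (1 / (2 * \<sigma>\<^sup>2 * (1 + b\<^sup>2)) * \<bar>f x\<bar>)) \<partial>\<mu>) \<le> 2"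
proof -
  interpret log_sobolev_space \<mu> G "\<sigma>\<^sup>2"
    using assms by (simp add: log_sobolev_space_def log_sobolev_space_axioms_def)
  define s where "s = \<sigma>\<^sup>2"
  define B where "B = b\<^sup>2"
  have s: "s > 0" and B: "B \<ge> 0" using assms(4) by (auto simp: s_def B_def)
  define E where "E = expectation (\<lambda>x. (norm (gradient f x))\<^sup>2)"
  have int: "integrable \<mu> (\<lambda>x. (norm (gradient f x))\<^sup>2)" and E: "E \<le> s * B"
    using expectation_sq_gradient_le[OF assms(6,8,10,13)] by (simp_all add: E_def s_def B_def)
  define c where "c = 1 / (2 * s * (1 + B))"
  define L where "L = 4 / 3 * c"
  define r where "r = (s * L)\<^sup>2"
  have "s * L = 2 / (3 * (1 + B))"
  proof -
    have sc: "s * c = 1 / (2 * (1 + B))" using s by (simp add: c_def)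
    have "s * L = 4 / 3 * (s * c)" by (simp add: L_def)
    also have "\<dots> = (4 * 1) / (3 * (2 * (1 + B)))"
      unfolding sc by (rule times_divide_times_eq)
    also have "\<dots> = 2 / (3 * (1 + B))"
      by (subst frac_eq_eq) (use B in \<open>auto simp: algebra_simps\<close>)
    finally show ?thesis .
  qed
  then have "r = 2\<^sup>2 / (3\<^sup>2 * (1 + B)\<^sup>2)"
    by (simp only: r_def power_divide power_mult_distrib)
  then have r: "r = 4 / (9 * (1 + B)\<^sup>2)" by simp
  have B1: "(1 + B)\<^sup>2 > 0" using B by simp
  \<comment> \<open>Equivalent to \<open>r B / (1 - 2 r) \<le> 2/9\<close>; this leaves enough room since \<open>2/9 \<le> ln 2 / 3\<close>, and the
    choice of 4/3 makes the terms linear in \<open>B\<close> cancel.\<close>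
  have "4 * (4 + 9 * B) \<le> 18 * (1 + B)\<^sup>2"
    using B by (simp add: power2_eq_square algebra_simps)
  then have rB: "r * (4 + 9 * B) \<le> 2"
    using B1 by (simp add: r divide_le_eq)
  have r1: "2 * r < 1"
  proof -
    have "1 \<le> (1 + B)\<^sup>2" using B by (simp add: one_le_power)
    then show ?thesis using B1 by (simp add: r divide_less_eq)
  qed
  have L: "0 < L" using s B by (simp add: L_def c_def)
  have "L\<^sup>2 * (s * E / (1 - 2 * r)) \<le> L\<^sup>2 * (s * (s * B) / (1 - 2 * r))"
    using s E r1 by (intro mult_left_mono divide_right_mono) auto
  also have "\<dots> = r * B / (1 - 2 * r)" by (simp add: r_def power2_eq_square)
  also have "\<dots> \<le> 2 / 9" using r1 rB by (simp add: divide_le_eq algebra_simps)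
  also have "\<dots> \<le> ln 2 / 3" using ln2_ge_two_thirds by simp
  finally have q: "L\<^sup>2 * (s * E / (1 - 2 * r)) \<le> ln 2 / 3" .
  note bounds = exp_le_expectation_sq_gradient[OF assms(6,7,9,12) int L, folded s_def E_def, folded r_def, OF _ r1]
  have "(\<integral>\<^sup>+ x. ennreal (exp (c * \<bar>f x\<bar>)) \<partial>\<mu>) \<le> 2"
  proof (rule nn_integral_exp_abs_le_2[OF assms(2)])
    show "f \<in> borel_measurable \<mu>" using assms(7) by simp
    show "(\<integral>\<^sup>+ x. ennreal (exp (4 / 3 * c * f x)) \<partial>\<mu>) \<le> ennreal (exp (ln 2 / 3))"
      unfolding L_def[symmetric] by (rule order_trans[OF bounds(1)]) (auto simp only: exp_le_cancel_iff intro!: ennreal_leI q)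
    show "(\<integral>\<^sup>+ x. ennreal (exp (4 / 3 * c * - f x)) \<partial>\<mu>) \<le> ennreal (exp (ln 2 / 3))"
      unfolding L_def[symmetric] by (rule order_trans[OF bounds(2)]) (auto simp only: exp_le_cancel_iff intro!: ennreal_leI q)
  qed
  then show ?thesis by (simp add: c_def s_def B_def)
qed

end
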